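(* Let $q$ be a power of $2$ and $n\ge 1$. The number of involutions in $Sp(2n,q)$ is equal to $$\sum_{\substack{0\le r\le n\\ r \text{ even}}} \frac{|Sp(2n,q)|}{A_r} +\sum_{\substack{1\le r\le n\\ r \text{ even}}} \frac{|Sp(2n,q)|}{B_r}+ \sum_{\substack{1\le r\le n\\ r \text{ odd}}} \frac{|Sp(2n,q)|}{C_r},$$ where $$A_r= q^{r(r+1)/2+r(2n-2r)}\,|Sp(r,q)|\,|Sp(2n-2r,q)|,$$ $$B_r= q^{r(r+1)/2+r(2n-2r)}\,q^{r-1}\,|Sp(r-2,q)|\,|Sp(2n-2r,q)|,$$ $$C_r= q^{r(r+1)/2+r(2n-2r)}\,|Sp(r-1,q)|\,|Sp(2n-2r,q)|.$$
   Context: $Sp(2m,q)$ is the symplectic group of a nondegenerate alternating bilinear form on the $2m$-dimensional vector space over the field with $q$ elements; its order is $|Sp(2m,q)|=q^{m^2}\prod_{i=1}^m (q^{2i}-1)$, with $|Sp(0,q)|=1$. "Involution" means an element $g$ with $g^2=1$ (the identity is counted; it corresponds to the $r=0$ term). *)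

theory Defs
  imports Complex_Main "HOL-Library.Cardinality" "HOL-Algebra.Group" "HOL-Algebra.Coset" "Jordan_Normal_Form.Matrix"
begin

definition bilinear_form :: "nat \<Rightarrow> ('a::field vec \<Rightarrow> 'a vec \<Rightarrow> 'a) \<Rightarrow> bool" where
  "bilinear_form d f \<longleftrightarrow>
     (\<forall>x\<in>carrier_vec d. \<forall>y\<in>carrier_vec d. \<forall>z\<in>carrier_vec d.
        f (x + y) z = f x z + f y z \<and> f z (x + y) = f z x + f z y) \<and>
     (\<forall>c. \<forall>x\<in>carrier_vec d. \<forall>y\<in>carrier_vec d.
        f (c \<cdot>\<^sub>v x) y = c * f x y \<and> f x (c \<cdot>\<^sub>v y) = c * f x y)"

(* Alternating means f x x = 0; in characteristic 2 this is stronger than skew-symmetry. *)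
definition alternating_form :: "nat \<Rightarrow> ('a::field vec \<Rightarrow> 'a vec \<Rightarrow> 'a) \<Rightarrow> bool" where
  "alternating_form d f \<longleftrightarrow> (\<forall>x\<in>carrier_vec d. f x x = 0)"

definition nondegenerate_form :: "nat \<Rightarrow> ('a::field vec \<Rightarrow> 'a vec \<Rightarrow> 'a) \<Rightarrow> bool" where
  "nondegenerate_form d f \<longleftrightarrow>
     (\<forall>x\<in>carrier_vec d. (\<forall>y\<in>carrier_vec d. f x y = 0) \<longrightarrow> x = 0\<^sub>v d)"

definition symplectic_form :: "nat \<Rightarrow> ('a::field vec \<Rightarrow> 'a vec \<Rightarrow> 'a) \<Rightarrow> bool" where
  "symplectic_form d f \<longleftrightarrow>
     bilinear_form d f \<and> alternating_form d f \<and> nondegenerate_form d f"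

(* The first argument is the dimension of the space, so Sp(2m,q) is Sp (2*m) f for a
   symplectic form f. For d = 0 the carrier consists of the empty matrix alone. *)
definition Sp :: "nat \<Rightarrow> ('a::field vec \<Rightarrow> 'a vec \<Rightarrow> 'a) \<Rightarrow> 'a mat monoid" where
  "Sp d f = \<lparr>carrier = {g \<in> carrier_mat d d. invertible_mat g \<and>
                (\<forall>x\<in>carrier_vec d. \<forall>y\<in>carrier_vec d. f (g *\<^sub>v x) (g *\<^sub>v y) = f x y)},
             monoid.mult = (*), one = 1\<^sub>m d\<rparr>"

lemma Sp_group: "group (Sp d f)"
proof (rule groupI)
  fix g h assume g: "g \<in> carrier (Sp d f)" and h: "h \<in> carrier (Sp d f)"
  from g obtain g' where g': "g * g' = 1\<^sub>m d" "g' * g = 1\<^sub>m (dim_row g')" "g \<in> carrier_mat d d"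
    by (auto simp: Sp_def invertible_mat_def inverts_mat_def)
  have gc: "g' \<in> carrier_mat d d"
    using g' by (metis carrier_matD carrier_matI index_mult_mat(2,3) index_one_mat(2,3))
  from h obtain h' where h': "h * h' = 1\<^sub>m d" "h' * h = 1\<^sub>m (dim_row h')" "h \<in> carrier_mat d d"
    by (auto simp: Sp_def invertible_mat_def inverts_mat_def)
  have hc: "h' \<in> carrier_mat d d"
    using h' by (metis carrier_matD carrier_matI index_mult_mat(2,3) index_one_mat(2,3))
  have "(g * h) * (h' * g') = g * (h * h') * g'"
    using g'(3) h'(3) gc hc by (simp add: assoc_mult_mat[of _ d d _ d _ d])
  then have 1: "(g * h) * (h' * g') = 1\<^sub>m d"
    using g' h' by simp
  have "(h' * g') * (g * h) = h' * (g' * g) * h"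
    using g'(3) h'(3) gc hc by (simp add: assoc_mult_mat[of _ d d _ d _ d])
  then have 2: "(h' * g') * (g * h) = 1\<^sub>m d"
    using g' h' gc hc by simp
  have "invertible_mat (g * h)"
    unfolding invertible_mat_def inverts_mat_def
    using 1 2 g'(3) h'(3) gc hc by (intro conjI exI[of _ "h' * g'"]) auto
  then show "g \<otimes>\<^bsub>Sp d f\<^esub> h \<in> carrier (Sp d f)"
    using g h by (auto simp: Sp_def assoc_mult_mat_vec[of _ d d _ d])
next
  show "\<one>\<^bsub>Sp d f\<^esub> \<in> carrier (Sp d f)"
    by (auto simp: Sp_def invertible_mat_def inverts_mat_def intro!: exI[of _ "1\<^sub>m d"])
next
  fix x y z assume "x \<in> carrier (Sp d f)" "y \<in> carrier (Sp d f)" "z \<in> carrier (Sp d f)"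
  then show "x \<otimes>\<^bsub>Sp d f\<^esub> y \<otimes>\<^bsub>Sp d f\<^esub> z = x \<otimes>\<^bsub>Sp d f\<^esub> (y \<otimes>\<^bsub>Sp d f\<^esub> z)"
    by (auto simp: Sp_def)
next
  fix x assume "x \<in> carrier (Sp d f)"
  then show "\<one>\<^bsub>Sp d f\<^esub> \<otimes>\<^bsub>Sp d f\<^esub> x = x" by (auto simp: Sp_def)
next
  fix g assume g: "g \<in> carrier (Sp d f)"
  from g obtain g' where g': "g * g' = 1\<^sub>m d" "g' * g = 1\<^sub>m (dim_row g')" "g \<in> carrier_mat d d"
    by (auto simp: Sp_def invertible_mat_def inverts_mat_def)
  have gc: "g' \<in> carrier_mat d d"
    using g' by (metis carrier_matD carrier_matI index_mult_mat(2,3) index_one_mat(2,3))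
  have "invertible_mat g'"
    unfolding invertible_mat_def inverts_mat_def using g' gc by auto
  moreover have "f (g' *\<^sub>v x) (g' *\<^sub>v y) = f x y" if "x \<in> carrier_vec d" "y \<in> carrier_vec d" for x y
  proof -
    have "f (g *\<^sub>v (g' *\<^sub>v x)) (g *\<^sub>v (g' *\<^sub>v y)) = f (g' *\<^sub>v x) (g' *\<^sub>v y)"
      using g gc that by (auto simp: Sp_def)
    then show ?thesis
      using that g' gc by (simp add: assoc_mult_mat_vec[of _ d d _ d, symmetric])
  qed
  ultimately show "\<exists>y\<in>carrier (Sp d f). y \<otimes>\<^bsub>Sp d f\<^esub> g = \<one>\<^bsub>Sp d f\<^esub>"
    using g' gc by (auto simp: Sp_def intro!: bexI[of _ g'])
qed

(* The identity counts as an involution. *)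
definition involutions :: "('g, 'b) monoid_scheme \<Rightarrow> 'g set" where
  "involutions G = {g \<in> carrier G. g [^]\<^bsub>G\<^esub> (2::nat) = \<one>\<^bsub>G\<^esub>}"

end

theory Submission
  imports Defs "Jordan_Normal_Form.Determinant" "HOL-Library.Function_Algebras"
begin

text \<open>In characteristic 2 the involutions of a symplectic group are the maps \<open>1 + N\<close> where \<open>N\<close> is
  self-adjoint for the form \<open>B\<close> and \<open>N\<^sup>2 = 0\<close>. Such maps are counted by rank. Double counting the
  pairs \<open>(N, w)\<close> with \<open>w \<noteq> 0\<close> and \<open>N w = 0\<close> gives a recursion: complete \<open>w\<close> to a hyperbolic pair
  \<open>(w, u)\<close> with orthogonal complement \<open>U\<close>. The maps \<open>N\<close> killing \<open>w\<close> correspond to triples \<open>(M, c, a)\<close>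
  where \<open>M\<close> is a map of the same kind on \<open>U\<close>, \<open>c\<close> lies in the kernel of \<open>M\<close> and \<open>a\<close> is a scalar:
  \<open>c\<close> and \<open>a\<close> are the components of \<open>N u\<close> in \<open>U\<close> and along \<open>w\<close>. The rank of \<open>N\<close> exceeds that of \<open>M\<close>
  by 2 if \<open>c\<close> is not in the image of \<open>M\<close>; if \<open>c = M y\<close>, it exceeds it by 1, except for the single value
  \<open>a = B c y\<close>, for which the ranks agree.

  The recursion is solved by (number of independent totally isotropic \<open>r\<close>-tuples) times a factor
  depending only on \<open>r\<close>, which is the sum of the reciprocals of the factors \<open>|Sp(r,q)|\<close>,
  \<open>q^(r-1) |Sp(r-2,q)|\<close>, \<open>|Sp(r-1,q)|\<close> in the statement. The orders of the symplectic groups follow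
  from the action on hyperbolic pairs by the same splitting.\<close>

hide_const (open) Polynomial.order

section \<open>Alternating forms over finite fields of characteristic 2\<close>

text \<open>Every nonempty fibre of an additive map is a translate of the kernel, so fibres over the
  image all have the same size.\<close>

lemma card_eq_kernel_times_image:
  fixes h :: "'v::ab_group_add \<Rightarrow> 'w::ab_group_add"
  assumes "finite V"
    and add: "\<And>x y. x \<in> V \<Longrightarrow> y \<in> V \<Longrightarrow> x + y \<in> V"
    and diff: "\<And>x y. x \<in> V \<Longrightarrow> y \<in> V \<Longrightarrow> x - y \<in> V"
    and hom: "\<And>x y. x \<in> V \<Longrightarrow> y \<in> V \<Longrightarrow> h (x + y) = h x + h y"
  shows "card V = card {x\<in>V. h x = 0} * card (h ` V)"
    and "z \<in> h ` V \<Longrightarrow> card {x\<in>V. h x = z} = card {x\<in>V. h x = 0}"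
proof -
  have fibre: "card {x\<in>V. h x = z} = card {x\<in>V. h x = 0}" if "z \<in> h ` V" for z
  proof -
    obtain x0 where x0: "x0 \<in> V" "h x0 = z" using \<open>z \<in> h ` V\<close> by blast
    have hd: "h (x - y) = h x - h y" if "x \<in> V" "y \<in> V" for x y
      using hom[of "x - y" y] that diff by (simp add: algebra_simps)
    have "bij_betw (\<lambda>x. x + x0) {x\<in>V. h x = 0} {x\<in>V. h x = z}"
      by (rule bij_betw_byWitness[where f' = "\<lambda>x. x - x0"]) (use x0 add diff hom hd in auto)
    then show ?thesis by (simp add: bij_betw_same_card)
  qed
  then show "z \<in> h ` V \<Longrightarrow> card {x\<in>V. h x = z} = card {x\<in>V. h x = 0}" .
  have "card V = (\<Sum>z\<in>h ` V. card {x\<in>V. h x = z})"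
    using sum.image_gen[OF \<open>finite V\<close>, of "\<lambda>_. 1::nat" h] by (simp only: card_eq_sum)
  also have "\<dots> = card {x\<in>V. h x = 0} * card (h ` V)"
    using fibre by simp
  finally show "card V = card {x\<in>V. h x = 0} * card (h ` V)" .
qed

lemma card_field_ge_2: "2 \<le> CARD('a::{field,finite})"
proof -
  have "card {0, 1::'a} \<le> CARD('a)" by (rule card_mono) auto
  then show ?thesis by simp
qed

text \<open>\<open>B\<close> may be degenerate on the ambient type, which may be infinite.
  Nondegeneracy is asked only of finite subspaces, so a space and the orthogonal complements met in
  the inductions live in one type with one form.\<close>

locale char2_alternating_form = vector_space scale
  for scale :: "'a::{field,finite} \<Rightarrow> 'v::ab_group_add \<Rightarrow> 'v" (infixr \<open>*s\<close> 75) +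
  fixes B :: "'v \<Rightarrow> 'v \<Rightarrow> 'a" and q :: nat
  assumes card_scalars: "CARD('a) = q"
    and one_add_one: "(1::'a) + 1 = 0"
    and B_add_left: "B (x + y) z = B x z + B y z"
    and B_add_right: "B z (x + y) = B z x + B z y"
    and B_scale_left: "B (c *s x) y = c * B x y"
    and B_scale_right: "B x (c *s y) = c * B x y"
    and B_self [simp]: "B x x = 0"
begin

lemma field_double [simp]: "a + a = (0::'a)"
  using one_add_one by (metis distrib_left mult.right_neutral mult_zero_right)

lemma double [simp]: "x + x = (0::'v)"
  by (metis field_double scale_left_distrib scale_one scale_zero_left)

lemma double_left [simp]: "x + (x + y) = (y::'v)" "a + (a + b) = (b::'a)"
  by (simp_all add: add.assoc[symmetric])

lemma field_add_eq_0: "a + b = 0 \<longleftrightarrow> a = (b::'a)"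
  by (metis add_right_cancel field_double)

lemma B_sym: "B x y = B y x"
proof -
  have "B x y + B y x = B (x + y) (x + y)"
    unfolding B_add_left B_add_right by simp
  also have "\<dots> = 0" by (rule B_self)
  finally show ?thesis by (rule field_add_eq_0[THEN iffD1])
qed

lemma orthogonal_sym: "B x y = 0 \<Longrightarrow> B y x = 0"
  by (simp add: B_sym[of y x])

lemma B_zero [simp]: "B 0 x = 0" "B x 0 = 0"
  by (metis B_scale_left mult_zero_left scale_zero_left, metis B_scale_right mult_zero_left scale_zero_left)

lemmas B_simps = B_add_left B_add_right B_scale_left B_scale_right

lemma q_ge_2: "2 \<le> q"
  using card_field_ge_2[where 'a='a] card_scalars by simp

definition symplectic :: "'v set \<Rightarrow> bool" where
  "symplectic V \<longleftrightarrow> finite V \<and> subspace V \<and> (\<forall>x\<in>V. (\<forall>y\<in>V. B x y = 0) \<longrightarrow> x = 0)"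

lemma image_functional:
  assumes "subspace W" "y \<in> W" "B x y \<noteq> 0"
  shows "B x ` W = UNIV"
proof -
  have "c \<in> B x ` W" for c
    using assms by (intro image_eqI[of _ _ "(c / B x y) *s y"]) (auto simp: B_simps subspace_scale)
  then show ?thesis by auto
qed

text \<open>A nonzero functional on \<open>W\<close> is onto the scalars and takes each of the
  \<open>q\<close> values equally often.\<close>

lemma card_functional:
  assumes "finite W" "subspace W" "y \<in> W" "B x y \<noteq> 0"
  shows "card {z\<in>W. B x z = c} * q = card W"
proof -
  note * = card_eq_kernel_times_image[of W "B x"]
  have im: "B x ` W = UNIV" using assms image_functional by blast
  have "card W = card {z\<in>W. B x z = 0} * card (B x ` W)"
    by (rule *(1)) (use assms in \<open>auto simp: subspace_add subspace_diff B_simps\<close>)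
  moreover have "card {z\<in>W. B x z = c} = card {z\<in>W. B x z = 0}"
    by (rule *(2)) (use assms im in \<open>auto simp: subspace_add subspace_diff B_simps\<close>)
  ultimately show ?thesis using im card_scalars by simp
qed

text \<open>Both sides come from counting the pairs \<open>(x, y)\<close> with \<open>B x y = 0\<close> by rows and by columns.\<close>
lemma card_orthogonal:
  assumes W: "finite W" "subspace W" and V: "finite V" "subspace V"
  shows "card W * card {y\<in>V. \<forall>x\<in>W. B x y = 0} = card V * card {x\<in>W. \<forall>y\<in>V. B x y = 0}"
proof -
  have count: "q * card {(x, y)\<in>W \<times> V. B x y = 0}
      = (q - 1) * (card V * card {x\<in>W. \<forall>y\<in>V. B x y = 0}) + card W * card V"
    if W: "finite W" "subspace W" and V: "finite V" "subspace V" for W V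
  proof -
    let ?W0 = "{x\<in>W. \<forall>y\<in>V. B x y = 0}"
    \<comment> \<open>The factor \<open>q\<close> avoids division: a row on which \<open>B x\<close>
      is a nonzero functional contributes \<open>card V\<close>, a row orthogonal to all of
      \<open>V\<close> contributes \<open>(q - 1) * card V\<close> more.\<close>
    have row: "q * card {y\<in>V. B x y = 0} = card V + (if x \<in> ?W0 then (q - 1) * card V else 0)"
      if "x \<in> W" for x
    proof (cases "x \<in> ?W0")
      case True
      then have "{y\<in>V. B x y = 0} = V" by auto
      moreover have "q * card V = card V + (q - 1) * card V" using q_ge_2 by (cases q) auto
      ultimately show ?thesis using True by simp
    next
      case False
      with \<open>x \<in> W\<close> obtain y where "y \<in> V" "B x y \<noteq> 0" by auto
      then show ?thesis using card_functional[OF V, of y x 0] False by (auto simp: mult.commute)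
    qed
    have "{(x, y)\<in>W \<times> V. B x y = 0} = (SIGMA x:W. {y\<in>V. B x y = 0})" by auto
    then have "q * card {(x, y)\<in>W \<times> V. B x y = 0} = (\<Sum>x\<in>W. q * card {y\<in>V. B x y = 0})"
      using W V by (simp add: card_SigmaI sum_distrib_left)
    also have "\<dots> = (\<Sum>x\<in>W. card V + (if x \<in> ?W0 then (q - 1) * card V else 0))"
      using row by (intro sum.cong) auto
    also have "\<dots> = (\<Sum>x\<in>W. card V) + (\<Sum>x\<in>W. if x \<in> ?W0 then (q - 1) * card V else 0)"
      by (rule sum.distrib)
    also have "(\<Sum>x\<in>W. if x \<in> ?W0 then (q - 1) * card V else 0) = (\<Sum>x\<in>?W0. (q - 1) * card V)"
      by (rule sum.mono_neutral_cong_right) (use W in auto)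
    finally have "q * card {(x, y)\<in>W \<times> V. B x y = 0} = card W * card V + card ?W0 * ((q - 1) * card V)"
      unfolding sum_constant of_nat_id .
    also have "\<dots> = (q - 1) * (card V * card ?W0) + card W * card V"
      by (simp only: ac_simps)
    finally show ?thesis .
  qed
  have "bij_betw prod.swap {(x, y)\<in>W \<times> V. B x y = 0} {(x, y)\<in>V \<times> W. B y x = 0}"
    by (rule bij_betw_byWitness[where f' = prod.swap]) auto
  then have "card {(x, y)\<in>W \<times> V. B x y = 0} = card {(x, y)\<in>V \<times> W. B y x = 0}"
    by (rule bij_betw_same_card)
  also have "{(x, y)\<in>V \<times> W. B y x = 0} = {(x, y)\<in>V \<times> W. B x y = 0}"
    using orthogonal_sym by blast
  finally have "q * card {(x, y)\<in>W \<times> V. B x y = 0} = q * card {(x, y)\<in>V \<times> W. B x y = 0}"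
    by (rule arg_cong)
  then have "(q - 1) * (card V * card {x\<in>W. \<forall>y\<in>V. B x y = 0}) + card W * card V
      = (q - 1) * (card W * card {y\<in>V. \<forall>x\<in>W. B y x = 0}) + card V * card W"
    unfolding count[OF W V] count[OF V W] .
  moreover have "q - 1 \<noteq> 0" using q_ge_2 by simp
  ultimately have "card V * card {x\<in>W. \<forall>y\<in>V. B x y = 0} = card W * card {y\<in>V. \<forall>x\<in>W. B y x = 0}"
    by (simp only: mult.commute[of "card W" "card V"] add_right_cancel mult_cancel1) simp
  moreover have "{y\<in>V. \<forall>x\<in>W. B y x = 0} = {y\<in>V. \<forall>x\<in>W. B x y = 0}"
    using orthogonal_sym by blast
  ultimately show ?thesis by simp
qed

text \<open>Maps are extensional on \<open>V\<close>: maps that agree on \<open>V\<close> are equal,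
  and between finite spaces there are finitely many, so sets of maps can be counted.\<close>

definition linear_map :: "'v set \<Rightarrow> 'v set \<Rightarrow> ('v \<Rightarrow> 'v) set" where
  "linear_map V V' = {h \<in> V \<rightarrow>\<^sub>E V'. (\<forall>x\<in>V. \<forall>y\<in>V. h (x + y) = h x + h y) \<and>
      (\<forall>c. \<forall>x\<in>V. h (c *s x) = c *s h x)}"

definition isometries :: "'v set \<Rightarrow> 'v set \<Rightarrow> ('v \<Rightarrow> 'v) set" where
  "isometries V V' = {h \<in> linear_map V V'. \<forall>x\<in>V. \<forall>y\<in>V. B (h x) (h y) = B x y}"

definition sqzero :: "'v set \<Rightarrow> ('v \<Rightarrow> 'v) set" where
  "sqzero V = {N \<in> linear_map V V. (\<forall>x\<in>V. \<forall>y\<in>V. B (N x) y = B x (N y)) \<and> (\<forall>x\<in>V. N (N x) = 0)}"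

lemma linear_mapD:
  assumes "h \<in> linear_map V V'"
  shows "x \<in> V \<Longrightarrow> h x \<in> V'" "x \<in> V \<Longrightarrow> y \<in> V \<Longrightarrow> h (x + y) = h x + h y"
    "x \<in> V \<Longrightarrow> h (c *s x) = c *s h x" "h \<in> extensional V"
  using assms by (auto simp: linear_map_def PiE_def)

lemma sqzeroD:
  assumes "N \<in> sqzero V"
  shows "N \<in> linear_map V V" "x \<in> V \<Longrightarrow> y \<in> V \<Longrightarrow> B (N x) y = B x (N y)" "x \<in> V \<Longrightarrow> N (N x) = 0"
  using assms by (auto simp: sqzero_def)

lemma linear_map_0:
  assumes "h \<in> linear_map V V'" "subspace V"
  shows "h 0 = 0"
  using linear_mapD(3)[OF assms(1), of 0 0] assms(2) by (simp add: subspace_0)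

lemma finite_linear_map: "finite V \<Longrightarrow> finite V' \<Longrightarrow> finite (linear_map V V')"
  unfolding linear_map_def by (rule finite_subset[OF _ finite_PiE[of V "\<lambda>_. V'"]]) auto

lemma finite_sqzero: "finite V \<Longrightarrow> finite (sqzero V)"
  unfolding sqzero_def using finite_linear_map by (rule finite_subset[rotated]) auto

lemma card_kernel_image:
  assumes "h \<in> linear_map V V'" "finite V" "subspace V"
  shows "card {x\<in>V. h x = 0} * card (h ` V) = card V"
  by (rule card_eq_kernel_times_image(1)[symmetric])
    (use assms linear_mapD(2)[OF assms(1)] in \<open>auto simp: subspace_add subspace_diff\<close>)

lemma subspace_kernel:
  assumes "h \<in> linear_map V V'" "subspace V"
  shows "subspace {x\<in>V. h x = 0}"
  using assms linear_mapD(2,3)[OF assms(1)] linear_map_0[OF assms]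
  by (auto simp: subspace_def)

text \<open>Self-adjointness puts the image inside the orthogonal complement of the kernel, and both
  have \<open>card V\<close> divided by the size of the kernel as their number of elements.\<close>

lemma sqzero_image_eq_kernel_orthogonal:
  assumes V: "symplectic V" and N: "N \<in> sqzero V"
  shows "N ` V = {y\<in>V. \<forall>x\<in>V. N x = 0 \<longrightarrow> B x y = 0}"
proof (rule card_subset_eq)
  note L = sqzeroD(1)[OF N]
  have fin: "finite V" "subspace V" using V by (auto simp: symplectic_def)
  let ?K = "{x\<in>V. N x = 0}"
  show "finite {y\<in>V. \<forall>x\<in>V. N x = 0 \<longrightarrow> B x y = 0}" using fin by simp
  show "N ` V \<subseteq> {y\<in>V. \<forall>x\<in>V. N x = 0 \<longrightarrow> B x y = 0}"
    using linear_mapD(1)[OF L] by (auto simp: sqzeroD(2)[OF N, symmetric])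
  have eq: "{x\<in>?K. \<forall>y\<in>V. B x y = 0} = {0}"
    using V linear_map_0[OF L] by (auto simp: symplectic_def subspace_0)
  have "card ?K * card {y\<in>V. \<forall>x\<in>?K. B x y = 0} = card V * card {x\<in>?K. \<forall>y\<in>V. B x y = 0}"
    by (rule card_orthogonal) (use fin subspace_kernel[OF L] in auto)
  also have "\<dots> = card ?K * card (N ` V)"
    unfolding eq using card_kernel_image[OF L] fin by simp
  finally have "card ?K * card {y\<in>V. \<forall>x\<in>?K. B x y = 0} = card ?K * card (N ` V)" .
  moreover have "card ?K \<noteq> 0"
    using fin linear_map_0[OF L] subspace_0[of V] by auto
  moreover have "{y\<in>V. \<forall>x\<in>?K. B x y = 0} = {y\<in>V. \<forall>x\<in>V. N x = 0 \<longrightarrow> B x y = 0}" by auto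
  ultimately show "card (N ` V) = card {y\<in>V. \<forall>x\<in>V. N x = 0 \<longrightarrow> B x y = 0}" by simp
qed

end

section \<open>Splitting off a hyperbolic plane\<close>

context char2_alternating_form begin

lemma symplecticD:
  assumes "symplectic V"
  shows "finite V" "subspace V" "x \<in> V \<Longrightarrow> (\<And>y. y \<in> V \<Longrightarrow> B x y = 0) \<Longrightarrow> x = 0"
    and "0 \<in> V" "x \<in> V \<Longrightarrow> y \<in> V \<Longrightarrow> x + y \<in> V" "x \<in> V \<Longrightarrow> c *s x \<in> V"
  using assms by (auto simp: symplectic_def subspace_0 subspace_add subspace_scale)

definition hyperbolic_pairs :: "'v set \<Rightarrow> ('v \<times> 'v) set" where
  "hyperbolic_pairs V = {(w, u) \<in> V \<times> V. B w u = 1}"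

definition ortho :: "'v set \<Rightarrow> 'v \<Rightarrow> 'v \<Rightarrow> 'v set" where
  "ortho V w u = {x\<in>V. B w x = 0 \<and> B u x = 0}"

text \<open>Orthogonal projection onto \<open>ortho V w u\<close> along the plane spanned by the
  hyperbolic pair; in characteristic 2 all signs are plus.\<close>

definition proj :: "'v \<Rightarrow> 'v \<Rightarrow> 'v \<Rightarrow> 'v" where
  "proj w u x = x + B u x *s w + B w x *s u"

lemma proj_decomp: "x = proj w u x + B u x *s w + B w x *s u"
  by (simp add: proj_def ac_simps)

lemma proj_add: "proj w u (x + y) = proj w u x + proj w u y"
  by (simp add: proj_def B_simps scale_left_distrib ac_simps)

lemma proj_scale: "proj w u (c *s x) = c *s proj w u x"
  by (simp add: proj_def B_simps scale_right_distrib)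

lemma proj_ortho: "x \<in> ortho V w u \<Longrightarrow> proj w u x = x"
  by (simp add: proj_def ortho_def)

lemma proj_mem:
  assumes "subspace V" "w \<in> V" "u \<in> V" "B w u = 1" "x \<in> V"
  shows "proj w u x \<in> ortho V w u"
  using assms B_sym[of u w] by (simp add: proj_def ortho_def B_simps subspace_add subspace_scale)

lemma hyperbolic_partner:
  assumes V: "symplectic V" and "w \<in> V" "w \<noteq> 0"
  obtains u where "u \<in> V" "B w u = 1"
proof -
  obtain y where y: "y \<in> V" "B w y \<noteq> 0" using symplecticD(3)[OF V \<open>w \<in> V\<close>] \<open>w \<noteq> 0\<close> by blast
  show thesis
    by (rule that[of "(1 / B w y) *s y"]) (use y V in \<open>auto simp: B_simps symplecticD\<close>)
qed

text \<open>A vector of the complement that is orthogonal to the complement is also orthogonal to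
  \<open>w\<close> and \<open>u\<close>, hence to the whole of \<open>V\<close>.\<close>

lemma symplectic_ortho:
  assumes V: "symplectic V" and w: "w \<in> V" "u \<in> V" "B w u = 1"
  shows "symplectic (ortho V w u)"
  unfolding symplectic_def
proof (intro conjI ballI impI)
  note [simp] = symplecticD(4-6)[OF V]
  show "finite (ortho V w u)" using symplecticD(1)[OF V] by (simp add: ortho_def)
  show "subspace (ortho V w u)"
    by (rule subspaceI) (auto simp: ortho_def B_simps)
  fix x assume x: "x \<in> ortho V w u" "\<forall>y\<in>ortho V w u. B x y = 0"
  show "x = 0"
  proof (rule symplecticD(3)[OF V])
    show "x \<in> V" using x by (simp add: ortho_def)
    fix y assume y: "y \<in> V"
    have "B x (proj w u y) = 0" using x proj_mem[OF symplecticD(2)[OF V] w y] by simp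
    moreover have "B x w = 0" "B x u = 0" using x B_sym[of x] by (simp_all add: ortho_def)
    ultimately show "B x y = 0" by (subst proj_decomp[of y w u]) (simp add: B_simps)
  qed
qed

lemma card_ortho:
  assumes V: "symplectic V" and w: "w \<in> V" "u \<in> V" "B w u = 1"
  shows "card V = q\<^sup>2 * card (ortho V w u)"
proof -
  let ?W = "{x\<in>V. B w x = 0}"
  have fin: "finite V" "subspace V" using symplecticD[OF V] by auto
  have 1: "card ?W * q = card V"
    by (rule card_functional[OF fin w(2)]) (use w in simp)
  \<comment> \<open>Since \<open>B w w = 0\<close>, the vector \<open>w\<close> lies in
    \<open>?W\<close>, and \<open>B u w = 1\<close> shows that \<open>B u\<close> is a nonzero
    functional there. Each of the two conditions therefore divides the size by
    \<open>q\<close>.\<close>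
  have "card {x\<in>?W. B u x = 0} * q = card ?W"
  proof (rule card_functional[of _ w])
    show "subspace ?W" by (rule subspaceI) (auto simp: B_simps symplecticD[OF V])
  qed (use fin w B_sym[of u w] in auto)
  moreover have "{x\<in>?W. B u x = 0} = ortho V w u" by (auto simp: ortho_def)
  ultimately show ?thesis using 1 by (simp add: power2_eq_square ac_simps)
qed

text \<open>Any nonzero vector can be \<open>w\<close>; the partners \<open>u\<close> form a fibre
  of the nonzero functional \<open>B w\<close>, a fraction \<open>1/q\<close> of
  \<open>V\<close>.\<close>

lemma card_hyperbolic_pairs:
  assumes V: "symplectic V"
  shows "card (hyperbolic_pairs V) * q = (card V - 1) * card V"
proof -
  have fin: "finite V" "subspace V" using symplecticD[OF V] by auto
  have "hyperbolic_pairs V = (SIGMA w:V - {0}. {u\<in>V. B w u = 1})"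
    by (auto simp: hyperbolic_pairs_def)
  then have "card (hyperbolic_pairs V) * q = (\<Sum>w\<in>V - {0}. card {u\<in>V. B w u = 1} * q)"
    using fin by (simp add: card_SigmaI sum_distrib_right)
  also have "\<dots> = (\<Sum>w\<in>V - {0}. card V)"
  proof (rule sum.cong)
    fix w assume "w \<in> V - {0}"
    then obtain u where "u \<in> V" "B w u = 1" using hyperbolic_partner[OF V] by blast
    then show "card {u\<in>V. B w u = 1} * q = card V" using card_functional[OF fin, of u w 1] by simp
  qed simp
  also have "\<dots> = (card V - 1) * card V" using symplecticD[OF V] by simp
  finally show ?thesis .
qed

lemma symplectic_card_1:
  assumes "symplectic V" "card V = 1"
  shows "V = {0}"
  using assms symplecticD(4)[OF assms(1)] by (auto simp: card_1_singleton_iff)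

definition join_isometry :: "'v set \<Rightarrow> 'v \<Rightarrow> 'v \<Rightarrow> ('v \<times> 'v) \<times> ('v \<Rightarrow> 'v) \<Rightarrow> 'v \<Rightarrow> 'v" where
  "join_isometry V w u = (\<lambda>((w', u'), h). restrict (\<lambda>x. h (proj w u x) + B u x *s w' + B w x *s u') V)"

definition split_isometry :: "'v set \<Rightarrow> 'v \<Rightarrow> 'v \<Rightarrow> ('v \<Rightarrow> 'v) \<Rightarrow> ('v \<times> 'v) \<times> ('v \<Rightarrow> 'v)" where
  "split_isometry V w u h = ((h w, h u), restrict h (ortho V w u))"

text \<open>An isometry sends \<open>(w, u)\<close> to a hyperbolic pair of \<open>V'\<close> and
  the complement of the first pair into the complement of the second; conversely such data glue. Two
  spaces are carried along because the complement of the image pair varies with the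
  isometry.\<close>

lemma bij_split_isometry:
  assumes V: "symplectic V" and V': "symplectic V'" and w: "w \<in> V" "u \<in> V" "B w u = 1"
  shows "bij_betw (split_isometry V w u) (isometries V V')
    (SIGMA p:hyperbolic_pairs V'. isometries (ortho V w u) (ortho V' (fst p) (snd p)))"
proof -
  note sV = symplecticD[OF V] and sV' = symplecticD[OF V']
  let ?U = "ortho V w u"
  have U: "?U \<subseteq> V" by (auto simp: ortho_def)
  have pr: "proj w u x \<in> ?U" if "x \<in> V" for x by (rule proj_mem[OF sV(2) w that])
  have join_split: "join_isometry V w u (split_isometry V w u h) = h"
      "split_isometry V w u h \<in> (SIGMA p:hyperbolic_pairs V'. isometries ?U (ortho V' (fst p) (snd p)))"
    if h: "h \<in> isometries V V'" for h
  proof -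
    have L: "h \<in> linear_map V V'" using h by (simp add: isometries_def)
    show "join_isometry V w u (split_isometry V w u h) = h"
    proof (rule extensionalityI[of _ V])
      fix x assume x: "x \<in> V"
      have "h x = h (proj w u x + B u x *s w + B w x *s u)" by (simp add: proj_decomp[symmetric])
      also have "\<dots> = h (proj w u x) + B u x *s h w + B w x *s h u"
        using pr[OF x] U w by (auto simp: linear_mapD(2,3)[OF L] sV subset_iff)
      finally show "join_isometry V w u (split_isometry V w u h) x = h x"
        using x pr by (simp add: join_isometry_def split_isometry_def)
    qed (use linear_mapD(4)[OF L] in \<open>auto simp: join_isometry_def split_isometry_def\<close>)
    have B: "B (h x) (h y) = B x y" if "x \<in> V" "y \<in> V" for x y
      using h that by (simp add: isometries_def)
    show "split_isometry V w u h
        \<in> (SIGMA p:hyperbolic_pairs V'. isometries ?U (ortho V' (fst p) (snd p)))"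
      using w linear_mapD[OF L] U symplecticD(2)[OF symplectic_ortho[OF V w]]
      by (auto simp: split_isometry_def hyperbolic_pairs_def isometries_def linear_map_def B
        ortho_def sV subspace_add subspace_scale B_simps)
  qed
  have split_join: "split_isometry V w u (join_isometry V w u ((w', u'), h)) = ((w', u'), h)"
      "join_isometry V w u ((w', u'), h) \<in> isometries V V'"
    if p: "(w', u') \<in> hyperbolic_pairs V'" and h: "h \<in> isometries ?U (ortho V' w' u')" for w' u' h
  proof -
    have L: "h \<in> linear_map ?U (ortho V' w' u')" using h by (simp add: isometries_def)
    have w': "w' \<in> V'" "u' \<in> V'" "B w' u' = 1" using p by (auto simp: hyperbolic_pairs_def)
    have Bh: "B (h x) (h y) = B x y" if "x \<in> ?U" "y \<in> ?U" for x y
      using h that by (simp add: isometries_def)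
    have hV: "h x \<in> V'" "B w' (h x) = 0" "B u' (h x) = 0" "B (h x) w' = 0" "B (h x) u' = 0" if "x \<in> ?U" for x
      using linear_mapD(1)[OF L that] B_sym[of "h x"] by (auto simp: ortho_def)
    have h0: "h 0 = 0" using linear_map_0[OF L] symplecticD(2)[OF symplectic_ortho[OF V w]] by simp
    have pw: "proj w u w = 0" "proj w u u = 0" using w B_sym[of u w] by (simp_all add: proj_def)
    let ?j = "join_isometry V w u ((w', u'), h)"
    have j: "?j x = h (proj w u x) + B u x *s w' + B w x *s u'" if "x \<in> V" for x
      using that by (simp add: join_isometry_def)
    show "split_isometry V w u ?j = ((w', u'), h)"
      unfolding split_isometry_def
    proof (intro arg_cong2[where f = Pair] extensionalityI[of _ ?U])
      show "h \<in> extensional ?U" by (rule linear_mapD(4)[OF L])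
      show "?j w = w'" "?j u = u'" using j w pw h0 B_sym[of u w] by auto
      fix x assume x: "x \<in> ?U"
      then show "restrict ?j ?U x = h x" using j U proj_ortho[OF x] by (auto simp: ortho_def)
    qed simp
    have jV: "?j x \<in> V'" if "x \<in> V" for x
      using that j pr[OF that] hV w' by (simp add: sV')
    have Bj: "B (?j x) (?j y) = B x y" if x: "x \<in> V" and y: "y \<in> V" for x y
    proof -
      have *: "B (h (proj w u x)) (h (proj w u y)) = B (proj w u x) (proj w u y)"
        using Bh pr x y by blast
      have o: "B (proj w u z) w = 0" "B (proj w u z) u = 0" "B w (proj w u z) = 0" "B u (proj w u z) = 0"
        if "z \<in> V" for z using pr[OF that] B_sym[of "proj w u z"] by (auto simp: ortho_def)
      \<comment> \<open>Complement and plane are orthogonal on both sides, so only the products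
        inside the complement and inside the plane survive.\<close>
      have "B (?j x) (?j y) = B (proj w u x) (proj w u y) + B u x * B w y + B w x * B u y"
        using hV[OF pr[OF x]] hV[OF pr[OF y]] w' B_sym[of u' w']
        by (simp add: j x y B_simps * ac_simps)
      also have "\<dots> = B (proj w u x + B u x *s w + B w x *s u) (proj w u y + B u y *s w + B w y *s u)"
        using o[OF x] o[OF y] w B_sym[of u w] by (simp add: B_simps ac_simps)
      finally show ?thesis by (simp add: proj_decomp[symmetric])
    qed
    have "?j \<in> linear_map V V'"
      unfolding linear_map_def
    proof (intro CollectI conjI ballI allI PiE_I)
      fix x y c assume x: "x \<in> V" and y: "y \<in> V"
      show "?j (x + y) = ?j x + ?j y"
        using pr[OF x] pr[OF y] x y
        by (simp add: j sV proj_add linear_mapD(2)[OF L] B_simps scale_left_distrib ac_simps)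
    next
      fix c x assume x: "x \<in> V"
      show "?j (c *s x) = c *s ?j x"
        using pr[OF x] x
        by (simp add: j sV proj_scale linear_mapD(3)[OF L] B_simps scale_right_distrib)
    qed (use jV in \<open>auto simp: join_isometry_def\<close>)
    then show "?j \<in> isometries V V'" using Bj by (simp add: isometries_def)
  qed
  show ?thesis
  proof (rule bij_betw_byWitness[where f' = "join_isometry V w u"], goal_cases)
    case 1
    show ?case using join_split(1) by blast
  next
    case 2
    show ?case using split_join by auto
  next
    case 3
    show ?case using join_split(2) by blast
  next
    case 4
    show ?case using split_join by auto
  qed
qed

end

section \<open>Orders of the symplectic groups\<close>

text \<open>This is |Sp(2m,q)|: the factor passing from \<open>m\<close> to \<open>Suc m\<close> is
  the number of hyperbolic pairs in dimension \<open>2 * m + 2\<close>. Unfolding collects the odd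
  exponents to \<open>m ^ 2\<close>.\<close>

primrec sp_order :: "nat \<Rightarrow> nat \<Rightarrow> nat" where
  "sp_order q 0 = 1"
| "sp_order q (Suc m) = (q ^ (2 * m + 2) - 1) * q ^ (2 * m + 1) * sp_order q m"

context char2_alternating_form begin

lemma card_ortho_power:
  assumes "symplectic V" "w \<in> V" "u \<in> V" "B w u = 1" "card V = q ^ (2 * Suc m)"
  shows "card (ortho V w u) = q ^ (2 * m)"
proof -
  have "q\<^sup>2 * card (ortho V w u) = q\<^sup>2 * q ^ (2 * m)"
    using card_ortho[OF assms(1-4)] assms(5) by (simp only: mult_Suc_right power_add)
  then show ?thesis using q_ge_2 by simp
qed

lemma symplectic_nonzero:
  assumes "symplectic V" "card V = q ^ (2 * Suc m)"
  obtains w where "w \<in> V" "w \<noteq> 0"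
proof -
  have "1 < card V" using assms(2) q_ge_2 one_less_power[of q "2 * Suc m"] by simp
  then have "V \<noteq> {0}" by auto
  then show thesis using symplecticD(4)[OF assms(1)] that by blast
qed

lemma card_isometries:
  assumes "symplectic V" "symplectic V'" "card V = q ^ (2 * m)" "card V' = q ^ (2 * m)"
  shows "card (isometries V V') = sp_order q m"
  using assms
proof (induction m arbitrary: V V')
  case 0
  then have V: "V = {0}" "V' = {0}" using symplectic_card_1 by auto
  have "isometries {0} {0} = {restrict (\<lambda>_. 0) {0}}"
    by (auto simp: isometries_def linear_map_def PiE_def extensional_def restrict_def fun_eq_iff)
  then show ?case by (simp add: V)
next
  case (Suc m)
  note V = \<open>symplectic V\<close> and V' = \<open>symplectic V'\<close>
  obtain w where "w \<in> V" "w \<noteq> 0" using symplectic_nonzero[OF V Suc.prems(3)] .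
  then obtain u where w: "w \<in> V" "u \<in> V" "B w u = 1" using hyperbolic_partner[OF V] by metis
  have fin: "finite (hyperbolic_pairs V')"
    using symplecticD(1)[OF V'] by (auto intro: finite_subset[of _ "V' \<times> V'"] simp: hyperbolic_pairs_def)
  have U: "symplectic (ortho V w u)" "card (ortho V w u) = q ^ (2 * m)"
    using symplectic_ortho[OF V w] card_ortho_power[OF V w] Suc.prems by auto
  have U': "symplectic (ortho V' w' u')" "card (ortho V' w' u') = q ^ (2 * m)"
    if "(w', u') \<in> hyperbolic_pairs V'" for w' u'
    using that symplectic_ortho[OF V'] card_ortho_power[OF V'] Suc.prems by (auto simp: hyperbolic_pairs_def)
  have "card (isometries V V') = card (SIGMA p:hyperbolic_pairs V'. isometries (ortho V w u) (ortho V' (fst p) (snd p)))"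
    by (rule bij_betw_same_card[OF bij_split_isometry[OF V V' w]])
  also have "\<dots> = (\<Sum>p\<in>hyperbolic_pairs V'. card (isometries (ortho V w u) (ortho V' (fst p) (snd p))))"
  proof (rule card_SigmaI[OF fin], rule ballI)
    fix p assume p: "p \<in> hyperbolic_pairs V'"
    have "finite (linear_map (ortho V w u) (ortho V' (fst p) (snd p)))"
      using symplecticD(1) U(1) U'(1)[of "fst p" "snd p"] p by (intro finite_linear_map) auto
    then show "finite (isometries (ortho V w u) (ortho V' (fst p) (snd p)))"
      by (rule finite_subset[rotated]) (auto simp: isometries_def)
  qed
  also have "\<dots> = (\<Sum>p\<in>hyperbolic_pairs V'. sp_order q m)"
    using Suc.IH[OF U(1) U'(1) U(2) U'(2)] by (intro sum.cong) auto
  also have "\<dots> = card (hyperbolic_pairs V') * sp_order q m" by simp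
  also have "card (hyperbolic_pairs V') = (q ^ (2 * m + 2) - 1) * q ^ (2 * m + 1)"
  proof -
    have "card (hyperbolic_pairs V') * q = ((q ^ (2 * m + 2) - 1) * q ^ (2 * m + 1)) * q"
      using card_hyperbolic_pairs[OF V'] Suc.prems by (simp add: ac_simps)
    then show ?thesis using q_ge_2 by simp
  qed
  finally show ?case by simp
qed

section \<open>Square-zero maps killing one vector of a hyperbolic pair\<close>

text \<open>The map with \<open>w\<close> sent to 0, \<open>u\<close> sent to
  \<open>c + a *s w\<close>, and \<open>y\<close> in the complement sent to
  \<open>M y + B c y *s w\<close>. The last coefficient is forced by self-adjointness: it equals
  \<open>B u (N y) = B (N u) y\<close>.\<close>

definition join_sqzero :: "'v set \<Rightarrow> 'v \<Rightarrow> 'v \<Rightarrow> ('v \<Rightarrow> 'v) \<times> 'v \<times> 'a \<Rightarrow> 'v \<Rightarrow> 'v" where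
  "join_sqzero V w u = (\<lambda>(M, c, a). restrict
    (\<lambda>x. M (proj w u x) + B w x *s c + (B c (proj w u x) + B w x * a) *s w) V)"

definition split_sqzero :: "'v set \<Rightarrow> 'v \<Rightarrow> 'v \<Rightarrow> ('v \<Rightarrow> 'v) \<Rightarrow> ('v \<Rightarrow> 'v) \<times> 'v \<times> 'a" where
  "split_sqzero V w u N = (restrict (\<lambda>x. proj w u (N x)) (ortho V w u), proj w u (N u), B u (N u))"

text \<open>If \<open>N\<close> kills \<open>w\<close>, self-adjointness makes every
  \<open>N x\<close> orthogonal to \<open>w\<close>, so \<open>N x\<close> has no
  \<open>u\<close>-component. The square of \<open>N\<close> then vanishes exactly when
  \<open>M\<close> has square zero and kills \<open>c\<close>. The scalar \<open>a\<close> is free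
  because it enters \<open>B (N x) y\<close> with the symmetric coefficient
  \<open>B w x * B w y\<close>.\<close>

lemma bij_join_sqzero:
  assumes V: "symplectic V" and w: "w \<in> V" "u \<in> V" "B w u = 1"
  shows "bij_betw (join_sqzero V w u)
    (SIGMA M:sqzero (ortho V w u). {c\<in>ortho V w u. M c = 0} \<times> UNIV) {N\<in>sqzero V. N w = 0}"
proof -
  note sV = symplecticD[OF V]
  let ?U = "ortho V w u"
  note sU = symplecticD[OF symplectic_ortho[OF V w]]
  have U: "?U \<subseteq> V" by (auto simp: ortho_def)
  have pr: "proj w u x \<in> ?U" if "x \<in> V" for x by (rule proj_mem[OF sV(2) w that])
  have o: "B x w = 0" "B x u = 0" "B w x = 0" "B u x = 0" if "x \<in> ?U" for x
    using that B_sym[of x] by (auto simp: ortho_def)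
  have Bproj: "B x (proj w u y) = B x y" "B (proj w u y) x = B y x" if "x \<in> ?U" for x y
    using o[OF that] B_sym[of _ x] by (simp_all add: proj_def B_simps)
  have Buw: "B u w = 1" using w B_sym[of u w] by simp
  have pw: "proj w u w = 0" "proj w u u = 0" using w Buw by (simp_all add: proj_def)
  have join_split: "join_sqzero V w u (split_sqzero V w u N) = N"
      "split_sqzero V w u N \<in> (SIGMA M:sqzero ?U. {c\<in>?U. M c = 0} \<times> UNIV)"
    if N: "N \<in> sqzero V" "N w = 0" for N
  proof -
    note sN = sqzeroD[OF N(1)]
    note L = linear_mapD[OF sN(1)]
    have wN: "B w (N x) = 0" if "x \<in> V" for x
      using sN(2)[OF w(1) that] N(2) by simp
    have Nx: "N x = proj w u (N x) + B u (N x) *s w" if "x \<in> V" for x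
      using proj_decomp[of "N x" w u] wN[OF that] by simp
    show "join_sqzero V w u (split_sqzero V w u N) = N"
    proof (rule extensionalityI[of _ V])
      fix x assume x: "x \<in> V"
      let ?y = "proj w u x"
      have y: "?y \<in> ?U" "?y \<in> V" using pr[OF x] U by auto
      have "B u (N ?y) = B (N u) ?y" using sN(2)[OF w(2) y(2)] by simp
      also have "\<dots> = B (proj w u (N u)) ?y" using Bproj(2)[OF y(1)] by simp
      finally have Bu: "B u (N ?y) = B (proj w u (N u)) ?y" .
      have "N x = N (?y + B u x *s w + B w x *s u)" by (simp add: proj_decomp[symmetric])
      also have "\<dots> = N ?y + B w x *s N u"
        using y w N(2) by (simp add: L sV)
      also have "\<dots> = proj w u (N ?y) + B u (N ?y) *s w + B w x *s (proj w u (N u) + B u (N u) *s w)"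
        using Nx[OF y(2)] Nx[OF w(2)] by simp
      finally show "join_sqzero V w u (split_sqzero V w u N) x = N x"
        using x y by (simp add: join_sqzero_def split_sqzero_def Bu scale_right_distrib scale_left_distrib ac_simps)
    qed (use L(4) in \<open>auto simp: join_sqzero_def split_sqzero_def\<close>)
    have Npr: "N (proj w u (N x)) = 0" if "x \<in> V" for x
    proof -
      have "N (N x) = N (proj w u (N x)) + B u (N x) *s N w"
        using that pr[OF L(1)[OF that]] U w by (subst Nx[OF that]) (auto simp: L sV)
      then show ?thesis using sN(3)[OF that] N(2) by simp
    qed
    have "restrict (\<lambda>x. proj w u (N x)) ?U \<in> sqzero ?U"
      unfolding sqzero_def linear_map_def
      using pr U sU Bproj Npr
      by (auto simp: L sV proj_add proj_scale sN(2) subset_iff)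
    then show "split_sqzero V w u N \<in> (SIGMA M:sqzero ?U. {c\<in>?U. M c = 0} \<times> UNIV)"
      using pr[OF L(1)[OF w(2)]] Npr[OF w(2)] by (auto simp: split_sqzero_def proj_def)
  qed
  have split_join: "split_sqzero V w u (join_sqzero V w u (M, c, a)) = (M, c, a)"
      "join_sqzero V w u (M, c, a) \<in> sqzero V" "join_sqzero V w u (M, c, a) w = 0"
    if M: "M \<in> sqzero ?U" and c: "c \<in> ?U" "M c = 0" for M c a
  proof -
    note sM = sqzeroD[OF M]
    note L = linear_mapD[OF sM(1)]
    let ?j = "join_sqzero V w u (M, c, a)"
    have M0: "M 0 = 0" using linear_map_0[OF sM(1)] sU by simp
    have j: "?j x = M (proj w u x) + B w x *s c + (B c (proj w u x) + B w x * a) *s w" if "x \<in> V" for x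
      using that by (simp add: join_sqzero_def)
    have mem: "M (proj w u x) + B w x *s c \<in> ?U" if "x \<in> V" for x
      using L(1)[OF pr[OF that]] c by (simp add: sU)
    have jV: "?j x \<in> V" if "x \<in> V" for x
      using mem[OF that] U w j[OF that] by (auto simp: sV)
    have pj: "proj w u (?j x) = M (proj w u x) + B w x *s c" if "x \<in> V" for x
      using proj_ortho[OF mem[OF that]] j[OF that] pw by (simp add: proj_add proj_scale)
    have wj: "B w (?j x) = 0" "B u (?j x) = B c (proj w u x) + B w x * a" if "x \<in> V" for x
      using o[OF mem[OF that]] j[OF that] Buw by (simp_all add: B_simps)
    show "?j w = 0" using j w pw M0 by simp
    show "split_sqzero V w u ?j = (M, c, a)"
      unfolding split_sqzero_def
    proof (intro arg_cong2[where f = Pair] extensionalityI[of _ ?U])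
      show "M \<in> extensional ?U" by (rule L(4))
      fix x assume x: "x \<in> ?U"
      then have "x \<in> V" using U by auto
      then show "restrict (\<lambda>x. proj w u (?j x)) ?U x = M x"
        using x pj o[OF x] proj_ortho[OF x] by simp
    next
      show "proj w u (?j u) = c" using pj w pw M0 by simp
      show "B u (?j u) = a" using wj w pw by simp
    qed simp
    \<comment> \<open>Exchanging \<open>x\<close> and \<open>y\<close> swaps the two middle terms
      and fixes the others, the first because \<open>M\<close> is self-adjoint.\<close>
    have Bj: "B (?j x) y = B (M (proj w u x)) (proj w u y) + B w x * B c (proj w u y)
        + B c (proj w u x) * B w y + B w x * B w y * a" if "x \<in> V" "y \<in> V" for x y
      using that Bproj(1)[OF c(1), of y] Bproj(1)[OF L(1)[OF pr[OF that(1)]], of y]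
      by (simp add: j B_simps algebra_simps)
    show "?j \<in> sqzero V"
      unfolding sqzero_def linear_map_def
    proof (intro CollectI conjI ballI allI PiE_I)
      fix x y c' assume x: "x \<in> V" and y: "y \<in> V"
      show "?j (x + y) = ?j x + ?j y"
        using pr[OF x] pr[OF y] x y
        by (simp add: j sV proj_add L(2) B_simps scale_left_distrib distrib_left ac_simps)
      have "B (M (proj w u x)) (proj w u y) = B (M (proj w u y)) (proj w u x)"
        using sM(2)[OF pr[OF x] pr[OF y]] B_sym by metis
      then show "B (?j x) y = B x (?j y)"
        unfolding B_sym[of x] Bj[OF x y] Bj[OF y x] by (simp add: ac_simps)
    next
      fix c' x assume x: "x \<in> V"
      show "?j (c' *s x) = c' *s ?j x"
        using pr[OF x] x
        by (simp add: j sV proj_scale L(3) B_simps scale_right_distrib distrib_left ac_simps)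
    next
      fix x assume x: "x \<in> V"
      let ?y = "proj w u x"
      have "M (M ?y + B w x *s c) = 0"
        using pr[OF x] L(1)[OF pr[OF x]] c by (simp add: L sU sM(3))
      moreover have "B c (M ?y) = 0"
        using sM(2)[OF c(1) pr[OF x]] c by simp
      ultimately show "?j (?j x) = 0"
        by (simp add: j[OF jV[OF x]] pj[OF x] wj[OF x] B_simps)
    qed (use jV in \<open>auto simp: join_sqzero_def\<close>)
  qed
  show ?thesis
  proof (rule bij_betw_byWitness[where f' = "split_sqzero V w u"], goal_cases)
    case 1
    show ?case using split_join by auto
  next
    case 2
    show ?case using join_split(1) by blast
  next
    case 3
    show ?case using split_join by auto
  next
    case 4
    show ?case using join_split(2) by blast
  qed
qed

end

section \<open>Ranks of self-adjoint square-zero maps\<close>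

lemma filter_image: "{y\<in>f ` A. P y} = f ` {x\<in>A. P (f x)}"
  by blast

context char2_alternating_form begin

text \<open>If two sums \<open>z + b *s c\<close> agreed with different \<open>b\<close>, then a
  nonzero multiple of \<open>c\<close>, hence \<open>c\<close> itself, would lie in
  \<open>S\<close>.\<close>

lemma card_span_image:
  assumes "finite S" "\<And>z z'. z \<in> S \<Longrightarrow> z' \<in> S \<Longrightarrow> z + z' \<in> S" "\<And>b z. z \<in> S \<Longrightarrow> b *s z \<in> S" "c \<notin> S"
  shows "card ((\<lambda>(z, b). z + b *s c) ` (S \<times> UNIV)) = q * card S"
proof -
  have "inj_on (\<lambda>(z, b). z + b *s c) (S \<times> UNIV)"
  proof (rule inj_onI, clarify)
    fix z b z' b' assume z: "z \<in> S" "z' \<in> S" and eq: "z + b *s c = z' + b' *s c"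
    have "z + z' = (b + b') *s c"
      using arg_cong[OF eq, of "\<lambda>x. z' + b *s c + x"] by (simp add: scale_left_distrib ac_simps)
    then have "(b + b') *s c \<in> S" using z assms(2) by metis
    then have "b + b' = 0"
      using assms(3)[of "(b + b') *s c" "1 / (b + b')"] assms(4) by (cases "b + b' = 0") auto
    then have "b = b'" by (simp add: field_add_eq_0)
    then show "z = z' \<and> b = b'" using eq by simp
  qed
  then show ?thesis using card_scalars by (simp add: card_image card_cartesian_product)
qed

context
  fixes V w u M U
  assumes V: "symplectic V" and w: "w \<in> V" "u \<in> V" "B w u = 1"
    and M: "M \<in> sqzero U" and U_def: "U = ortho V w u"
begin

lemma symplectic_U: "symplectic U"
  unfolding U_def by (rule symplectic_ortho[OF V w])

lemma image_closed:
  "z \<in> M ` U \<Longrightarrow> z' \<in> M ` U \<Longrightarrow> z + z' \<in> M ` U" "z \<in> M ` U \<Longrightarrow> b *s z \<in> M ` U"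
  using symplecticD[OF symplectic_U] linear_mapD(2,3)[OF sqzeroD(1)[OF M], symmetric] by auto

lemma image_subset: "M ` U \<subseteq> {c\<in>U. M c = 0}"
  using linear_mapD(1)[OF sqzeroD(1)[OF M]] sqzeroD(3)[OF M] by auto

text \<open>A vector of \<open>V\<close> is a combination of some \<open>y\<close> in
  \<open>U\<close>, of \<open>u\<close> and of \<open>w\<close>. As \<open>w\<close> is killed,
  \<open>y\<close> and the coefficient \<open>b\<close> of \<open>u\<close> already parametrize the
  image.\<close>

lemma join_image:
  assumes c: "c \<in> U" "M c = 0"
  shows "join_sqzero V w u (M, c, a) ` V = (\<lambda>(y, b). M y + b *s c + (B c y + b * a) *s w) ` (U \<times> UNIV)"
    (is "_ = ?h ` _")
proof (intro equalityI subsetI; elim imageE)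
  fix z x assume "x \<in> V" "z = join_sqzero V w u (M, c, a) x"
  then show "z \<in> ?h ` (U \<times> UNIV)"
    using proj_mem[OF symplecticD(2)[OF V] w, of x]
    by (intro image_eqI[of _ _ "(proj w u x, B w x)"]) (auto simp: join_sqzero_def U_def)
next
  fix z p assume "z = ?h p" "p \<in> U \<times> UNIV"
  then obtain y b where y: "y \<in> U" "z = ?h (y, b)" by auto
  then have y': "y \<in> V" "B w y = 0" "B u y = 0" by (auto simp: U_def ortho_def)
  have "proj w u (y + b *s u) = y"
    using w y' B_sym[of u w] by (simp add: proj_def B_simps ac_simps)
  then show "z \<in> join_sqzero V w u (M, c, a) ` V"
    using y y' w by (intro image_eqI[of _ _ "y + b *s u"])
      (auto simp: join_sqzero_def symplecticD[OF V] B_simps)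
qed

lemma w_notin: "w \<notin> U"
  using w B_sym[of u w] by (auto simp: U_def ortho_def)

text \<open>The image of \<open>M\<close> is the orthogonal complement of its kernel, so some
  \<open>k\<close> in the kernel has \<open>B c k\<close> nonzero. Adding multiples of
  \<open>k\<close> to \<open>y\<close> moves the \<open>w\<close>-coefficient freely without
  changing \<open>M y\<close>; the image is the image of \<open>M\<close> extended by the lines of
  \<open>c\<close> and of \<open>w\<close>.\<close>

lemma card_join_image_outside:
  assumes c: "c \<in> U" "M c = 0" and "c \<notin> M ` U"
  shows "card (join_sqzero V w u (M, c, a) ` V) = q\<^sup>2 * card (M ` U)"
proof -
  note fin = symplecticD[OF symplectic_U]
  note L = linear_mapD[OF sqzeroD(1)[OF M]]
  obtain k where k: "k \<in> U" "M k = 0" "B c k \<noteq> 0"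
    using sqzero_image_eq_kernel_orthogonal[OF symplectic_U M] assms orthogonal_sym by blast
  let ?S = "(\<lambda>(z, b). z + b *s c) ` (M ` U \<times> UNIV)"
  have "join_sqzero V w u (M, c, a) ` V = (\<lambda>(z, b). z + b *s w) ` (?S \<times> UNIV)"
    unfolding join_image[OF c]
  proof (intro equalityI subsetI; elim imageE)
    fix z p assume "z = (\<lambda>(z, b). z + b *s w) p" "p \<in> ?S \<times> UNIV"
    then obtain y b g where y: "y \<in> U" "z = M y + b *s c + g *s w" by auto
    \<comment> \<open>The multiple of \<open>k\<close> is chosen so that
      \<open>B c ?y + b * a\<close> becomes the prescribed coefficient \<open>g\<close>.\<close>
    let ?y = "y + ((g + b * a + B c y) / B c k) *s k"
    have "?y \<in> U" "M ?y = M y" "B c ?y = g + b * a"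
      using y k by (auto simp: L fin B_simps ac_simps)
    then show "z \<in> (\<lambda>(y, b). M y + b *s c + (B c y + b * a) *s w) ` (U \<times> UNIV)"
      using y by (intro image_eqI[of _ _ "(?y, b)"]) (auto simp: ac_simps)
  qed force
  moreover have "?S \<subseteq> U" using image_subset c fin by auto
  then have "w \<notin> ?S" using w_notin by auto
  moreover have "z + z' \<in> ?S" if z: "z \<in> ?S" "z' \<in> ?S" for z z'
  proof -
    obtain x b x' b' where "z = x + b *s c" "z' = x' + b' *s c" "x \<in> M ` U" "x' \<in> M ` U"
      using z by auto
    then show ?thesis
      by (intro image_eqI[of _ _ "(x + x', b + b')"]) (auto simp: scale_left_distrib ac_simps image_closed(1))
  qed
  moreover have "b *s z \<in> ?S" if z: "z \<in> ?S" for b z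
  proof -
    obtain x b' where "z = x + b' *s c" "x \<in> M ` U" using z by auto
    then show ?thesis
      by (intro image_eqI[of _ _ "(b *s x, b * b')"]) (auto simp: scale_right_distrib image_closed(2))
  qed
  ultimately have "card (join_sqzero V w u (M, c, a) ` V) = q * card ?S"
    using fin(1) by (simp only:) (intro card_span_image, auto)
  also have "card ?S = q * card (M ` U)"
    using fin(1) assms(3) image_closed by (intro card_span_image) auto
  finally show ?thesis by (simp add: power2_eq_square)
qed

text \<open>With \<open>z = M (y + b *s y0)\<close> the image consists of the vectors
  \<open>z + (B y0 z + b * e) *s w\<close>, where \<open>e = B (M y0) y0 + a\<close> and
  \<open>z\<close>, \<open>b\<close> vary independently. For \<open>e = 0\<close> this is the graph
  of a functional on the image of \<open>M\<close>; otherwise \<open>b * e\<close> takes every value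
  and the whole line of \<open>w\<close> is added.\<close>

lemma card_join_image_inside:
  assumes y0: "y0 \<in> U"
  shows "card (join_sqzero V w u (M, M y0, a) ` V)
    = (if a = B (M y0) y0 then card (M ` U) else q * card (M ` U))"
proof -
  note fin = symplecticD[OF symplectic_U]
  note sM = sqzeroD[OF M]
  note L = linear_mapD[OF sM(1)]
  have c: "M y0 \<in> U" "M (M y0) = 0" using y0 L sM by auto
  let ?e = "B (M y0) y0 + a"
  have shift: "M y + b *s M y0 + (B (M y0) y + b * a) *s w
      = M (y + b *s y0) + (B y0 (M (y + b *s y0)) + b * ?e) *s w" if "y \<in> U" for y b
  proof -
    have "B y0 (M (y + b *s y0)) = B (M y0) y + b * B (M y0) y0"
      using that y0 sM(2)[of y0 "y + b *s y0"] by (simp add: fin B_simps)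
    then show ?thesis using that y0 by (simp add: L fin distrib_left ac_simps)
  qed
  have *: "join_sqzero V w u (M, M y0, a) ` V
      = (\<lambda>(z, b). z + (B y0 z + b * ?e) *s w) ` (M ` U \<times> UNIV)"
    unfolding join_image[OF c]
  proof (intro equalityI subsetI; elim imageE)
    fix z p assume "z = (\<lambda>(y, b). M y + b *s M y0 + (B (M y0) y + b * a) *s w) p" "p \<in> U \<times> UNIV"
    then show "z \<in> (\<lambda>(z, b). z + (B y0 z + b * ?e) *s w) ` (M ` U \<times> UNIV)"
      using y0 shift
      by (intro image_eqI[of _ _ "(M (fst p + snd p *s y0), snd p)"]) (auto simp: fin)
  next
    fix z p assume "z = (\<lambda>(z, b). z + (B y0 z + b * ?e) *s w) p" "p \<in> M ` U \<times> UNIV"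
    then obtain y b where y: "y \<in> U" "z = M y + (B y0 (M y) + b * ?e) *s w" by auto
    have "z = (\<lambda>(y, b). M y + b *s M y0 + (B (M y0) y + b * a) *s w) (y + b *s y0, b)"
      using shift[of "y + b *s y0" b] y y0 by (simp add: fin add.assoc)
    then show "z \<in> (\<lambda>(y, b). M y + b *s M y0 + (B (M y0) y + b * a) *s w) ` (U \<times> UNIV)"
      by (rule image_eqI) (use y y0 in \<open>simp add: fin\<close>)
  qed
  show ?thesis
  proof (cases "a = B (M y0) y0")
    case True
    have "join_sqzero V w u (M, M y0, a) ` V = (\<lambda>z. z + B y0 z *s w) ` (M ` U)"
      unfolding * using True by force
    moreover have "inj_on (\<lambda>z. z + B y0 z *s w) (M ` U)"
    proof (rule inj_onI)
      fix z z' assume z: "z \<in> M ` U" "z' \<in> M ` U" and eq: "z + B y0 z *s w = z' + B y0 z' *s w"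
      have "B u z = 0" "B u z' = 0" using z L(1) by (auto simp: U_def ortho_def)
      then have "B y0 z = B y0 z'"
        using arg_cong[OF eq, of "B u"] w B_sym[of u w] by (simp add: B_simps)
      then show "z = z'" using eq by simp
    qed
    ultimately show ?thesis using True by (simp add: card_image)
  next
    case False
    then have e: "?e \<noteq> 0" using field_add_eq_0 by metis
    have "join_sqzero V w u (M, M y0, a) ` V = (\<lambda>(z, b). z + b *s w) ` (M ` U \<times> UNIV)"
      unfolding *
    proof (intro equalityI subsetI; elim imageE)
      fix z p assume "z = (\<lambda>(z, b). z + b *s w) p" "p \<in> M ` U \<times> UNIV"
      then show "z \<in> (\<lambda>(z, b). z + (B y0 z + b * ?e) *s w) ` (M ` U \<times> UNIV)"
        using e by (intro image_eqI[of _ _ "(fst p, (snd p + B y0 (fst p)) / ?e)"]) (auto simp: ac_simps)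
    qed force
    also have "card \<dots> = q * card (M ` U)"
      using image_closed w_notin image_subset fin(1) by (intro card_span_image) auto
    finally show ?thesis using False by simp
  qed
qed

lemma card_join_fibre:
  "card {(c, a) \<in> {c\<in>U. M c = 0} \<times> UNIV. card (join_sqzero V w u (M, c, a) ` V) = k}
    = (card {c\<in>U. M c = 0} - card (M ` U)) * (if k = q\<^sup>2 * card (M ` U) then q else 0)
    + card (M ` U) * ((if k = card (M ` U) then 1 else 0) + (if k = q * card (M ` U) then q - 1 else 0))"
proof -
  let ?K = "{c\<in>U. M c = 0}" and ?s = "card (M ` U)"
  let ?F = "\<lambda>c. {a. card (join_sqzero V w u (M, c, a) ` V) = k}"
  have fin: "finite ?K" using symplecticD(1)[OF symplectic_U] by simp
  have s: "?s > 0" using symplecticD(1,4)[OF symplectic_U] by (auto simp: card_gt_0_iff)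
  \<comment> \<open>The three possible sizes are distinct, so each \<open>k\<close> meets at most
    one of the cases.\<close>
  have qs: "q * ?s \<noteq> ?s" "q\<^sup>2 * ?s \<noteq> ?s" "q\<^sup>2 * ?s \<noteq> q * ?s"
    using s q_ge_2 by (auto simp: power2_eq_square)
  have inside: "card (?F c) = (if k = ?s then 1 else 0) + (if k = q * ?s then q - 1 else 0)" if c: "c \<in> M ` U" for c
  proof -
    obtain y0 where y0: "y0 \<in> U" "c = M y0" using c by auto
    have "?F c = (if k = ?s then {B c y0} else if k = q * ?s then UNIV - {B c y0} else {})"
      using card_join_image_inside[OF y0(1)] qs by (auto simp: y0(2))
    then show ?thesis using qs card_scalars by (auto simp: card_Diff_singleton)
  qed
  have outside: "card (?F c) = (if k = q\<^sup>2 * ?s then q else 0)" if "c \<in> ?K - M ` U" for c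
  proof -
    have "card (join_sqzero V w u (M, c, a) ` V) = q\<^sup>2 * ?s" for a
      by (rule card_join_image_outside) (use that in simp_all)
    then show ?thesis using card_scalars by (cases "k = q\<^sup>2 * ?s") simp_all
  qed
  have "{(c, a) \<in> ?K \<times> UNIV. card (join_sqzero V w u (M, c, a) ` V) = k} = (SIGMA c:?K. ?F c)" by auto
  then have "card {(c, a) \<in> ?K \<times> UNIV. card (join_sqzero V w u (M, c, a) ` V) = k} = (\<Sum>c\<in>?K. card (?F c))"
    using fin by (simp add: card_SigmaI)
  also have "\<dots> = (\<Sum>c\<in>?K - M ` U. card (?F c)) + (\<Sum>c\<in>M ` U. card (?F c))"
    by (rule sum.subset_diff[OF image_subset fin])
  also have "\<dots> = (\<Sum>c\<in>?K - M ` U. if k = q\<^sup>2 * ?s then q else 0)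
      + (\<Sum>c\<in>M ` U. (if k = ?s then 1 else 0) + (if k = q * ?s then q - 1 else 0))"
    by (intro arg_cong2[where f = "(+)"] sum.cong refl inside outside)
  also have "\<dots> = (card ?K - ?s) * (if k = q\<^sup>2 * ?s then q else 0)
      + ?s * ((if k = ?s then 1 else 0) + (if k = q * ?s then q - 1 else 0))"
    unfolding sum_constant of_nat_id card_Diff_subset[OF finite_subset[OF image_subset fin] image_subset] ..
  finally show ?thesis .
qed

end

lemma sqzero_kernel_count:
  assumes V: "symplectic V" and w: "w \<in> V" "u \<in> V" "B w u = 1"
  defines "U \<equiv> ortho V w u"
  shows "card {N\<in>sqzero V. N w = 0 \<and> card (N ` V) = k} = (\<Sum>M\<in>sqzero U.
      (card {c\<in>U. M c = 0} - card (M ` U)) * (if k = q\<^sup>2 * card (M ` U) then q else 0)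
    + card (M ` U) * ((if k = card (M ` U) then 1 else 0) + (if k = q * card (M ` U) then q - 1 else 0)))"
proof -
  let ?J = "join_sqzero V w u"
  let ?D = "SIGMA M:sqzero U. {c\<in>U. M c = 0} \<times> UNIV"
  let ?E = "SIGMA M:sqzero U. {(c, a) \<in> {c\<in>U. M c = 0} \<times> UNIV. card (?J (M, c, a) ` V) = k}"
  have fin: "finite U" using symplecticD(1)[OF symplectic_ortho[OF V w]] by (simp add: U_def)
  have bij: "bij_betw ?J ?D {N\<in>sqzero V. N w = 0}"
    unfolding U_def by (rule bij_join_sqzero[OF V w])
  have E: "{d\<in>?D. card (?J d ` V) = k} = ?E"
  proof (rule Set.set_eqI)
    fix d :: "('v \<Rightarrow> 'v) \<times> 'v \<times> 'a"
    obtain M c a where "d = (M, c, a)" by (cases d)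
    then show "d \<in> {d\<in>?D. card (?J d ` V) = k} \<longleftrightarrow> d \<in> ?E"
      by (simp only: mem_Collect_eq mem_Sigma_iff prod.case conj_assoc)
  qed
  have "{N\<in>sqzero V. N w = 0 \<and> card (N ` V) = k} = {N\<in>?J ` ?D. card (N ` V) = k}"
    unfolding bij_betw_imp_surj_on[OF bij] by (simp only: mem_Collect_eq conj_assoc)
  also have "\<dots> = ?J ` {d\<in>?D. card (?J d ` V) = k}" by (rule filter_image)
  finally have "card {N\<in>sqzero V. N w = 0 \<and> card (N ` V) = k} = card (?J ` {d\<in>?D. card (?J d ` V) = k})"
    by (rule arg_cong)
  also have "\<dots> = card {d\<in>?D. card (?J d ` V) = k}"
    by (rule card_image[OF inj_on_subset[OF bij_betw_imp_inj_on[OF bij] Collect_restrict]])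
  also have "\<dots> = card ?E" by (simp only: E)
  also have "\<dots> = (\<Sum>M\<in>sqzero U. card {(c, a) \<in> {c\<in>U. M c = 0} \<times> UNIV. card (?J (M, c, a) ` V) = k})"
  proof (rule card_SigmaI[OF finite_sqzero[OF fin]], rule ballI)
    fix M :: "'v \<Rightarrow> 'v"
    have "finite ({c\<in>U. M c = 0} \<times> (UNIV :: 'a set))" using fin by simp
    then show "finite {(c, a) \<in> {c\<in>U. M c = 0} \<times> UNIV. card (?J (M, c, a) ` V) = k}"
      by (rule finite_subset[rotated]) auto
  qed
  also have "\<dots> = (\<Sum>M\<in>sqzero U.
      (card {c\<in>U. M c = 0} - card (M ` U)) * (if k = q\<^sup>2 * card (M ` U) then q else 0)
    + card (M ` U) * ((if k = card (M ` U) then 1 else 0) + (if k = q * card (M ` U) then q - 1 else 0)))"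
    by (rule sum.cong[OF refl]) (rule card_join_fibre[OF V w _ U_def[THEN meta_eq_to_obj_eq]])
  finally show ?thesis .
qed

end

section \<open>Solving the rank recursion\<close>

text \<open>The sum of 1/|Aut| over the isometry classes of nondegenerate symmetric bilinear forms
  of rank \<open>r\<close> in characteristic 2; \<open>sym_weight_split\<close> exhibits the
  alternating and the nonalternating class.\<close>

definition sym_weight :: "nat \<Rightarrow> nat \<Rightarrow> real" where
  "sym_weight q r = (if even r then real q ^ r else 1) / real (sp_order q (r div 2))"

lemma sp_order_real_Suc:
  assumes "2 \<le> q"
  shows "real (sp_order q (Suc m)) = (real q ^ (2 * m + 2) - 1) * real q ^ (2 * m + 1) * real (sp_order q m)"
  using assms by (simp add: of_nat_diff Suc_le_eq)

lemma sp_order_pos: "2 \<le> q \<Longrightarrow> 0 < sp_order q m"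
proof (induction m)
  case (Suc m)
  then have "1 < q ^ (2 * m + 2)" by (intro one_less_power) auto
  then show ?case using Suc by simp
qed simp

text \<open>This is what is left of the recursion in \<open>rank_count_rec\<close> once the common
  frame count is divided out. After separating parities it is a rational identity in
  \<open>Q\<close>, \<open>x = Q ^ (2 * m + 1)\<close> and \<open>s\<close>, the order of
  Sp(2m,q).\<close>

lemma sym_weight_rec:
  assumes q: "2 \<le> q"
  shows "sym_weight q (r + 2) * real q ^ (r + 1) * (real q ^ (r + 2) - 1)
    = (real q - 1) * real q ^ (r + 1) * sym_weight q (r + 1) + real q * sym_weight q r"
proof -
  define Q where "Q = real q"
  have Q: "Q > 1" using q by (simp add: Q_def)
  obtain m where "r = 2 * m \<or> r = 2 * m + 1" by (metis oddE evenE)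
  moreover define s where "s = real (sp_order q m)"
  define x where "x = Q ^ (2 * m + 1)"
  have s: "s > 0" using sp_order_pos[OF q] by (simp add: s_def)
  have "1 < Q ^ (2 * m + 2)" using Q by (intro one_less_power) auto
  then have x: "x > 0" "Q * x > 1" using Q by (simp_all add: x_def)
  define D where "D = Q * x - 1"
  have D: "D \<noteq> 0" using x by (simp add: D_def)
  have Suc: "real (sp_order q (Suc m)) = (Q * x - 1) * x * s"
    unfolding sp_order_real_Suc[OF q] Q_def[symmetric] by (simp add: x_def s_def)
  ultimately show ?thesis
  proof (elim disjE)
    assume r: "r = 2 * m"
    have "sym_weight q (r + 2) = Q * x / ((Q * x - 1) * x * s)"
      "sym_weight q (r + 1) = 1 / s" "sym_weight q r = x / Q / s"
      using Q Suc by (simp_all add: sym_weight_def r s_def Q_def x_def del: sp_order.simps)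
    moreover have "Q ^ (r + 1) = x" "Q ^ (r + 2) = Q * x" using r by (simp_all add: x_def)
    moreover have "Q * x / (D * x * s) * x * D = (Q - 1) * x * (1 / s) + Q * (x / Q / s)"
      using D x s Q by (simp add: field_simps)
    ultimately show ?thesis unfolding Q_def[symmetric] by (simp only: D_def)
  next
    assume r: "r = 2 * m + 1"
    have "sym_weight q (r + 2) = 1 / ((Q * x - 1) * x * s)"
      "sym_weight q (r + 1) = Q * x / ((Q * x - 1) * x * s)" "sym_weight q r = 1 / s"
      using Q Suc by (simp_all add: sym_weight_def r s_def Q_def x_def del: sp_order.simps)
    moreover have "Q ^ (r + 1) = Q * x" "Q ^ (r + 2) = Q * Q * x" using r by (simp_all add: x_def)
    moreover have "1 / (D * x * s) * (Q * x) * (Q * Q * x - 1)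
        = (Q - 1) * (Q * x) * (Q * x / (D * x * s)) + Q * (1 / s)"
      using D x s Q by (simp add: divide_simps) (simp add: D_def algebra_simps)
    ultimately show ?thesis unfolding Q_def[symmetric] by (simp only: D_def)
  qed
qed

text \<open>With \<open>X = Q ^ (2 * n)\<close> this counts the linearly independent \<open>r\<close>-tuples spanning a totally
  isotropic subspace of a symplectic space of dimension \<open>2 * n\<close> over a field of order \<open>Q\<close>.\<close>
definition isotropic_frames :: "real \<Rightarrow> real \<Rightarrow> nat \<Rightarrow> real" where
  "isotropic_frames Q X r = (\<Prod>i<r. X / Q ^ i - Q ^ i)"

text \<open>Counting by the first vector \<open>w\<close> of the frame: it has \<open>X - 1\<close>
  choices, and the other \<open>r\<close> vectors are lifts, \<open>Q\<close> for each, of a frame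
  in the orthogonal complement of \<open>w\<close> modulo \<open>w\<close>, a space with
  \<open>X / Q ^ 2\<close> elements. Numerically this is the index shift in the product.\<close>

lemma isotropic_frames_front:
  assumes "Q > 0"
  shows "isotropic_frames Q X (Suc r) = (X - 1) * Q ^ r * isotropic_frames Q (X / Q\<^sup>2) r"
proof -
  have "isotropic_frames Q X (Suc r) = (X - 1) * (\<Prod>i<r. X / Q ^ Suc i - Q ^ Suc i)"
    by (simp add: isotropic_frames_def prod.lessThan_Suc_shift del: power_Suc prod.lessThan_Suc)
  also have "(\<Prod>i<r. X / Q ^ Suc i - Q ^ Suc i) = (\<Prod>i<r. Q * (X / Q\<^sup>2 / Q ^ i - Q ^ i))"
    using assms by (intro prod.cong) (auto simp: field_simps power2_eq_square)
  also have "\<dots> = Q ^ r * isotropic_frames Q (X / Q\<^sup>2) r"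
    by (simp add: prod.distrib isotropic_frames_def)
  finally show ?thesis by simp
qed

definition rank_count :: "nat \<Rightarrow> real \<Rightarrow> nat \<Rightarrow> real" where
  "rank_count q X r = isotropic_frames (real q) X r * sym_weight q r"

lemma rank_count_0: "rank_count q X 0 = 1" and rank_count_1: "rank_count q X (Suc 0) = X - 1"
  by (simp_all add: rank_count_def isotropic_frames_def sym_weight_def)

text \<open>The double count as an identity of numbers. On the left, each map of rank
  \<open>r + 2\<close> has \<open>X / Q ^ (r + 2) - 1\<close> nonzero kernel vectors; on the right,
  each of the \<open>X - 1\<close> nonzero vectors \<open>w\<close> is killed by the number of maps
  found from the complement, of size \<open>Y\<close>.\<close>

lemma rank_count_rec:
  fixes X :: real
  assumes q: "2 \<le> q"
  defines "Q \<equiv> real q"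
  defines "Y \<equiv> X / Q\<^sup>2"
  shows "rank_count q X (r + 2) * (X / Q ^ (r + 2) - 1)
    = (X - 1) * (Q ^ (r + 2) * rank_count q Y (r + 2) + (Q - 1) * Q ^ (r + 1) * rank_count q Y (r + 1)
      + Q * (Y / Q ^ r - Q ^ r) * rank_count q Y r)"
proof -
  have Q: "Q > 0" using q by (simp add: Q_def)
  define J P s0 s1 s2 where "J = isotropic_frames Q Y r" and "P = Y / Q ^ r - Q ^ r"
    and "s0 = sym_weight q r" and "s1 = sym_weight q (r + 1)" and "s2 = sym_weight q (r + 2)"
  have J1: "isotropic_frames Q Y (r + 1) = J * P"
    by (simp add: isotropic_frames_def J_def P_def)
  have J2: "isotropic_frames Q Y (r + 2) = J * P * (Y / Q ^ (r + 1) - Q ^ (r + 1))"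
    by (simp add: isotropic_frames_def J_def P_def)
  have X2: "isotropic_frames Q X (r + 2) = (X - 1) * Q ^ (r + 1) * (J * P)"
    using isotropic_frames_front[OF Q, of X "r + 1"] J1 by (simp add: Y_def)
  have s: "s2 * Q ^ (r + 1) * (Q ^ (r + 2) - 1) = (Q - 1) * Q ^ (r + 1) * s1 + Q * s0"
    using sym_weight_rec[OF q, of r] by (simp add: s0_def s1_def s2_def Q_def)
  have X: "X = Y * Q\<^sup>2" using Q by (simp add: Y_def)
  have a: "Q ^ (r + 1) * (X / Q ^ (r + 2) - 1) = Y * Q - Q ^ (r + 1)"
    using Q by (simp add: X field_simps power2_eq_square)
  have b: "Q ^ (r + 2) * (Y / Q ^ (r + 1) - Q ^ (r + 1)) = Y * Q - Q ^ (r + 2) * Q ^ (r + 1)"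
    using Q by (simp add: field_simps)
  have "rank_count q X (r + 2) * (X / Q ^ (r + 2) - 1)
      = (X - 1) * (J * P) * (s2 * (Q ^ (r + 1) * (X / Q ^ (r + 2) - 1)))"
    unfolding rank_count_def Q_def[symmetric] X2 s2_def[symmetric] by (simp only: ac_simps)
  \<comment> \<open>By \<open>a\<close> and \<open>b\<close> the coefficients of \<open>s2\<close>
    on the two sides of the claim differ by \<open>Q ^ (r + 1) * (Q ^ (r + 2) - 1)\<close>, which is
    where the recursion for the weights enters.\<close>
  also have "s2 * (Q ^ (r + 1) * (X / Q ^ (r + 2) - 1))
      = s2 * (Q ^ (r + 2) * (Y / Q ^ (r + 1) - Q ^ (r + 1))) + s2 * Q ^ (r + 1) * (Q ^ (r + 2) - 1)"
    unfolding a b by (simp add: algebra_simps)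
  also have "\<dots> = s2 * (Q ^ (r + 2) * (Y / Q ^ (r + 1) - Q ^ (r + 1)))
      + ((Q - 1) * Q ^ (r + 1) * s1 + Q * s0)" by (simp only: s)
  also have "(X - 1) * (J * P) * \<dots> = (X - 1) * (Q ^ (r + 2) * rank_count q Y (r + 2)
      + (Q - 1) * Q ^ (r + 1) * rank_count q Y (r + 1) + Q * P * rank_count q Y r)"
    unfolding rank_count_def Q_def[symmetric] J1 J2 J_def[symmetric] s0_def[symmetric] s1_def[symmetric] s2_def[symmetric]
    by (simp only: ring_distribs ac_simps)
  finally show ?thesis by (simp only: P_def)
qed

lemma sum_fibre:
  fixes g :: "nat \<Rightarrow> real"
  assumes "finite A"
  shows "(\<Sum>M\<in>A. if s M = k then g (s M) else 0) = g k * real (card {M\<in>A. s M = k})"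
proof -
  have "(\<Sum>M\<in>A. if s M = k then g (s M) else 0) = (\<Sum>M | M \<in> A \<and> s M = k. g k)"
    using assms by (intro sum.mono_neutral_cong_right) auto
  then show ?thesis by (simp add: mult.commute)
qed

section \<open>Counting square-zero maps by rank\<close>

context char2_alternating_form begin

lemma card_sqzero_image_kernel:
  assumes V: "symplectic V" and N: "N \<in> sqzero V"
  shows "card {x\<in>V. N x = 0} * card (N ` V) = card V" "card (N ` V) \<le> card {x\<in>V. N x = 0}" "0 < card (N ` V)"
proof -
  note sV = symplecticD[OF V] and sN = sqzeroD[OF N]
  show "card {x\<in>V. N x = 0} * card (N ` V) = card V" by (rule card_kernel_image[OF sN(1) sV(1,2)])
  have "N ` V \<subseteq> {x\<in>V. N x = 0}" using linear_mapD(1)[OF sN(1)] sN(3) by auto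
  then show "card (N ` V) \<le> card {x\<in>V. N x = 0}" using sV(1) by (intro card_mono) auto
  show "0 < card (N ` V)" using sV(1,4) by (auto simp: card_gt_0_iff)
qed

text \<open>A map of rank \<open>r\<close> killing \<open>w\<close> comes from an \<open>M\<close>
  of rank \<open>r\<close>, \<open>r - 1\<close> or \<open>r - 2\<close>. For \<open>r\<close> below
  2 some of these do not exist, which is why ranks 0 and 1 have equations of their own.\<close>

lemma sqzero_kernel_count_rank:
  assumes V: "symplectic V" and w: "w \<in> V" "u \<in> V" "B w u = 1"
  defines "U \<equiv> ortho V w u" and "Q \<equiv> real q"
  defines "T \<equiv> \<lambda>r. real (card {M\<in>sqzero U. card (M ` U) = q ^ r})"
  defines "K \<equiv> \<lambda>r. real (card {N\<in>sqzero V. N w = 0 \<and> card (N ` V) = q ^ r})"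
  shows "K 0 = T 0" "K (Suc 0) = Q * T (Suc 0) + (Q - 1) * T 0"
    "K (r + 2) = Q ^ (r + 2) * T (r + 2) + (Q - 1) * Q ^ (r + 1) * T (r + 1)
      + Q * (real (card U) / Q ^ r - Q ^ r) * T r"
proof -
  have U: "symplectic U" unfolding U_def by (rule symplectic_ortho[OF V w])
  have fin: "finite (sqzero U)" by (rule finite_sqzero[OF symplecticD(1)[OF U]])
  let ?s = "\<lambda>M :: 'v \<Rightarrow> 'v. card (M ` U)"
  have K: "real (card {N\<in>sqzero V. N w = 0 \<and> card (N ` V) = k}) =
      (\<Sum>M\<in>sqzero U. if q\<^sup>2 * ?s M = k then Q * (real (card U) / real (?s M) - real (?s M)) else 0)
    + (\<Sum>M\<in>sqzero U. if ?s M = k then real (?s M) else 0)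
    + (\<Sum>M\<in>sqzero U. if q * ?s M = k then (Q - 1) * real (?s M) else 0)" for k
    unfolding sqzero_kernel_count[OF V w] U_def[symmetric] of_nat_sum sum.distrib[symmetric]
  proof (rule sum.cong[OF refl])
    fix M assume M: "M \<in> sqzero U"
    have n: "q\<^sup>2 \<noteq> q" "Suc 0 \<noteq> q\<^sup>2" "q \<noteq> Suc 0" using q_ge_2 by (auto simp: power2_eq_square)
    note c = card_sqzero_image_kernel[OF U M]
    have "real (card {c\<in>U. M c = 0}) = real (card U) / real (?s M)"
      using c(3) by (simp add: c(1)[symmetric])
    then show "real ((card {c\<in>U. M c = 0} - ?s M) * (if k = q\<^sup>2 * ?s M then q else 0)
        + ?s M * ((if k = ?s M then 1 else 0) + (if k = q * ?s M then q - 1 else 0)))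
      = (if q\<^sup>2 * ?s M = k then Q * (real (card U) / real (?s M) - real (?s M)) else 0)
        + (if ?s M = k then real (?s M) else 0) + (if q * ?s M = k then (Q - 1) * real (?s M) else 0)"
      using c(2) q_ge_2 n by (auto simp: of_nat_diff Q_def algebra_simps)
  qed
  have pos: "?s M > 0" if "M \<in> sqzero U" for M using card_sqzero_image_kernel(3)[OF U that] .
  have s1: "(\<Sum>M\<in>sqzero U. if ?s M = q ^ r then real (?s M) else 0) = Q ^ r * T r" for r
    using sum_fibre[OF fin, of ?s "q ^ r" real] by (simp add: T_def Q_def)
  have s2: "(\<Sum>M\<in>sqzero U. if q * ?s M = q ^ Suc r then (Q - 1) * real (?s M) else 0) = (Q - 1) * Q ^ r * T r" for r
    using sum_fibre[OF fin, of ?s "q ^ r" "\<lambda>x. (Q - 1) * real x"] q_ge_2 by (simp add: T_def Q_def)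
  have s3: "(\<Sum>M\<in>sqzero U. if q\<^sup>2 * ?s M = q ^ (r + 2) then Q * (real (card U) / real (?s M) - real (?s M)) else 0)
      = Q * (real (card U) / Q ^ r - Q ^ r) * T r" for r
    using sum_fibre[OF fin, of ?s "q ^ r" "\<lambda>x. Q * (real (card U) / real x - real x)"] q_ge_2
    by (simp add: T_def Q_def power2_eq_square)
  \<comment> \<open>Rank 1 cannot arise by raising a rank by 2.\<close>
  have z: "q\<^sup>2 * ?s M \<noteq> q ^ Suc 0" if "M \<in> sqzero U" for M
    using pos[OF that] q_ge_2 by (simp add: power2_eq_square)
  have q_not_1: "q \<noteq> Suc 0" using q_ge_2 by simp
  show "K 0 = T 0"
    unfolding K_def K using s1[of 0] q_not_1 by simp
  show "K (Suc 0) = Q * T (Suc 0) + (Q - 1) * T 0"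
    unfolding K_def K s1 s2 using z by simp
  show "K (r + 2) = Q ^ (r + 2) * T (r + 2) + (Q - 1) * Q ^ (r + 1) * T (r + 1)
      + Q * (real (card U) / Q ^ r - Q ^ r) * T r"
    unfolding K_def K s1 s3 using s2[of "r + 1"] by simp
qed


lemma q_power_inject: "q ^ a = q ^ b \<longleftrightarrow> a = b"
  using q_ge_2 by (intro power_inject_exp) simp

text \<open>Every such map kills some nonzero vector, so it comes from a map on a smaller space, and
  each extension multiplies the image size by 1, \<open>q\<close> or \<open>q ^ 2\<close>. The bound
  on \<open>r\<close> holds because the image lies in the kernel, so its size squared is at most
  \<open>card V\<close>.\<close>

lemma card_sqzero_image_power:
  assumes "symplectic V" "card V = q ^ (2 * m)" "N \<in> sqzero V"
  shows "\<exists>r\<le>m. card (N ` V) = q ^ r"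
proof -
  have "\<exists>r. card (N ` V) = q ^ r"
    using assms
  proof (induction m arbitrary: V N)
    case 0
    then show ?case using symplectic_card_1[of V] by (intro exI[of _ 0]) simp
  next
    case (Suc m)
    note V = Suc.prems(1) and N = Suc.prems(3)
    obtain x where x: "x \<in> V" "x \<noteq> 0" using symplectic_nonzero[OF Suc.prems(1,2)] by blast
    \<comment> \<open>If \<open>N x\<close> is nonzero, it is itself in the kernel because the
      square of \<open>N\<close> is zero.\<close>
    obtain w where w: "w \<in> V" "w \<noteq> 0" "N w = 0"
    proof (cases "N x = 0")
      case True
      then show ?thesis using that x by blast
    next
      case False
      then show ?thesis
        using that[of "N x"] x linear_mapD(1)[OF sqzeroD(1)[OF N]] sqzeroD(3)[OF N] by blast
    qed
    obtain u where u: "u \<in> V" "B w u = 1" using hyperbolic_partner[OF V w(1,2)] by blast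
    let ?U = "ortho V w u"
    have "N \<in> join_sqzero V w u ` (SIGMA M:sqzero ?U. {c\<in>?U. M c = 0} \<times> UNIV)"
      using bij_betw_imp_surj_on[OF bij_join_sqzero[OF V w(1) u]] N w by simp
    then obtain M c a where M: "M \<in> sqzero ?U" "c \<in> ?U" "M c = 0" "N = join_sqzero V w u (M, c, a)"
      by auto
    obtain r where r: "card (M ` ?U) = q ^ r"
      using Suc.IH[OF symplectic_ortho[OF V w(1) u] card_ortho_power[OF V w(1) u Suc.prems(2)] M(1)] by blast
    show ?case
    proof (cases "c \<in> M ` ?U")
      case True
      then obtain y where "y \<in> ?U" "c = M y" by blast
      then have "card (N ` V) = q ^ r \<or> card (N ` V) = q ^ Suc r"
        using card_join_image_inside[OF V w(1) u M(1) refl, of y a] r M(4) by (simp split: if_splits)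
      then show ?thesis by blast
    next
      case False
      then have "card (N ` V) = q ^ (r + 2)"
        using card_join_image_outside[OF V w(1) u M(1) refl M(2,3) False, of a] r M(4)
        by (simp add: power2_eq_square)
      then show ?thesis by blast
    qed
  qed
  then obtain r where r: "card (N ` V) = q ^ r" by blast
  note c = card_sqzero_image_kernel[OF assms(1,3)]
  have "q ^ r * q ^ r \<le> card V"
    using mult_le_mono1[OF c(2), of "card (N ` V)"] unfolding c(1) unfolding r .
  then have "q ^ (2 * r) \<le> q ^ (2 * m)" unfolding assms(2) by (simp only: mult_2 power_add)
  then have "r \<le> m" using q_ge_2 by simp
  then show ?thesis using r by blast
qed

text \<open>Induction on the dimension. Counting the pairs \<open>(N, w)\<close> with
  \<open>N w = 0\<close> and \<open>w\<close> nonzero once by \<open>N\<close> and once by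
  \<open>w\<close> gives the same relation that \<open>rank_count\<close> satisfies.\<close>

lemma card_sqzero_rank:
  assumes "symplectic V" "card V = q ^ (2 * m)"
  shows "real (card {N\<in>sqzero V. card (N ` V) = q ^ r}) = rank_count q (real q ^ (2 * m)) r"
  using assms
proof (induction m arbitrary: V r)
  case 0
  have V: "V = {0}" using symplectic_card_1 0 by simp
  have "sqzero V = {restrict (\<lambda>_. 0) {0}}"
    by (auto simp: V sqzero_def linear_map_def PiE_def extensional_def restrict_def fun_eq_iff)
  moreover have "Suc 0 = q ^ r \<longleftrightarrow> r = 0" using q_power_inject[of 0 r] by auto
  ultimately have "{N\<in>sqzero V. card (N ` V) = q ^ r} = (if r = 0 then sqzero V else {})"
    by (auto simp: V)
  \<comment> \<open>The factor with index 0 in the frame count is \<open>1 - 1\<close>.\<close>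
  moreover have "rank_count q 1 r = 0" if "r \<noteq> 0"
    using that by (auto simp: rank_count_def isotropic_frames_def intro!: bexI[of _ 0])
  ultimately show ?case using \<open>sqzero V = _\<close> by (auto simp: rank_count_0)
next
  case (Suc m)
  note V = Suc.prems(1)
  define Q X where "Q = real q" and "X = Q ^ (2 * Suc m)"
  have Q: "Q > 1" using q_ge_2 by (simp add: Q_def)
  have fin: "finite V" "finite (sqzero V)" using symplecticD(1)[OF V] finite_sqzero by auto
  let ?T = "{N\<in>sqzero V. card (N ` V) = q ^ r}"
  show ?case
  proof (cases "r \<le> Suc m")
    case False
    then have T: "?T = {}"
      using card_sqzero_image_power[OF V Suc.prems(2)] q_power_inject by fastforce
    \<comment> \<open>The factor with index \<open>Suc m\<close> vanishes, since \<open>X\<close> is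
      the square of \<open>Q ^ Suc m\<close>.\<close>
    have "isotropic_frames Q X r = 0"
      using False Q by (auto simp: isotropic_frames_def X_def power_add mult_2 intro!: bexI[of _ "Suc m"])
    then have "rank_count q X r = 0" by (simp add: rank_count_def Q_def)
    then show ?thesis unfolding T X_def Q_def by simp
  next
    case True
    have K: "real (card {N\<in>sqzero V. N w = 0 \<and> card (N ` V) = q ^ r}) * (X - 1)
        = rank_count q X r * (X / Q ^ r - 1)" if w: "w \<in> V - {0}" for w
    proof -
      obtain u where u: "u \<in> V" "B w u = 1" using hyperbolic_partner[OF V] w by blast
      let ?U = "ortho V w u"
      have wV: "w \<in> V" using w by simp
      have cU: "card ?U = q ^ (2 * m)" by (rule card_ortho_power[OF V wV u Suc.prems(2)])
      have Y: "real (card ?U) = X / Q\<^sup>2" "Q ^ (2 * m) = X / Q\<^sup>2"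
        using Q by (simp_all add: cU X_def Q_def power2_eq_square)
      have T: "real (card {M\<in>sqzero ?U. card (M ` ?U) = q ^ r}) = rank_count q (X / Q\<^sup>2) r" for r
        using Suc.IH[OF symplectic_ortho[OF V wV u] cU] Y by (simp add: Q_def)
      note rec = sqzero_kernel_count_rank[OF V wV u, unfolded T Y(1) Q_def[symmetric]]
      \<comment> \<open>The number of maps killing \<open>w\<close> does not depend on
        \<open>w\<close>; ranks 0 and 1 are checked by hand and the others by the recursion.\<close>
      consider "r = 0" | "r = Suc 0" | r' where "r = r' + 2"
        by (metis add_2_eq_Suc' not0_implies_Suc)
      then show ?thesis
      proof cases
        case 1
        then show ?thesis using rec(1) by (simp add: rank_count_0)
      next
        case 2
        then have "real (card {N\<in>sqzero V. N w = 0 \<and> card (N ` V) = q ^ r}) = X / Q - 1"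
          using rec(2) Q by (simp add: rank_count_0 rank_count_1 field_simps power2_eq_square)
        then show ?thesis unfolding 2 by (simp add: rank_count_1)
      next
        case 3
        then show ?thesis using rec(3)[of r'] rank_count_rec[OF q_ge_2, of X r']
          by (simp only: Q_def[symmetric] ac_simps)
      qed
    qed
    have ker: "real (card {w\<in>V - {0}. N w = 0}) = X / Q ^ r - 1" if N: "N \<in> ?T" for N
    proof -
      have "N \<in> sqzero V" using N by simp
      note c = card_sqzero_image_kernel[OF V this] and L = sqzeroD(1)[OF this]
      have "0 \<in> {w\<in>V. N w = 0}" using linear_map_0[OF L] symplecticD(2,4)[OF V] by simp
      moreover have "{w\<in>V - {0}. N w = 0} = {w\<in>V. N w = 0} - {0}" by auto
      ultimately have "card {w\<in>V. N w = 0} = Suc (card {w\<in>V - {0}. N w = 0})"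
        using fin(1) card.remove[of "{w\<in>V. N w = 0}" 0] by simp
      moreover have "real (card {w\<in>V. N w = 0}) * Q ^ r = X"
        using arg_cong[OF c(1), of real] N Suc.prems(2) by (simp add: Q_def X_def)
      ultimately show ?thesis using Q by (simp add: field_simps)
    qed
    have "real (card ?T) * (X / Q ^ r - 1) = (\<Sum>N\<in>?T. real (card {w\<in>V - {0}. N w = 0}))"
      using ker by simp
    also have "\<dots> = (\<Sum>N\<in>?T. \<Sum>w\<in>V - {0}. if N w = 0 then 1 else 0)"
      using fin by (intro sum.cong refl) (simp add: sum.If_cases Int_def conj_commute)
    also have "\<dots> = (\<Sum>w\<in>V - {0}. \<Sum>N\<in>?T. if N w = 0 then 1 else 0)" by (rule sum.swap)
    also have "\<dots> = (\<Sum>w\<in>V - {0}. real (card {N\<in>sqzero V. N w = 0 \<and> card (N ` V) = q ^ r}))"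
    proof (rule sum.cong[OF refl])
      fix w
      have "{N\<in>?T. N w = 0} = {N\<in>sqzero V. N w = 0 \<and> card (N ` V) = q ^ r}" by auto
      moreover have "(\<Sum>N\<in>?T. if N w = 0 then 1 else 0) = real (card {N\<in>?T. N w = 0})"
        using fin by (simp add: sum.If_cases Int_def)
      ultimately show "(\<Sum>N\<in>?T. if N w = 0 then 1 else 0)
        = real (card {N\<in>sqzero V. N w = 0 \<and> card (N ` V) = q ^ r})" by simp
    qed
    also have "\<dots> = (\<Sum>w\<in>V - {0}. rank_count q X r * (X / Q ^ r - 1) / (X - 1))"
    proof (rule sum.cong[OF refl])
      fix w assume w: "w \<in> V - {0}"
      have "X > 1" unfolding X_def using Q by (intro one_less_power) auto
      then show "real (card {N\<in>sqzero V. N w = 0 \<and> card (N ` V) = q ^ r})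
          = rank_count q X r * (X / Q ^ r - 1) / (X - 1)"
        using K[OF w] by (simp add: field_simps)
    qed
    also have "\<dots> = rank_count q X r * (X / Q ^ r - 1)"
    proof -
      have X1: "X > 1" unfolding X_def using Q by (intro one_less_power) auto
      have "real (card (V - {0})) = X - 1"
        using card.remove[OF symplecticD(1,4)[OF V]] arg_cong[OF Suc.prems(2), of real]
        by (simp add: X_def Q_def)
      then show ?thesis using X1 by simp
    qed
    finally have "real (card ?T) * (X / Q ^ r - 1) = rank_count q X r * (X / Q ^ r - 1)" .
    \<comment> \<open>Since \<open>r\<close> is at most \<open>Suc m\<close>, the kernel is nonzero
      and the number of nonzero kernel vectors can be cancelled.\<close>
    moreover have "X / Q ^ r - 1 \<noteq> 0"
      using Q True power_strict_increasing[of r "2 * Suc m" Q] by (simp add: X_def)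
    ultimately have "real (card ?T) = rank_count q X r"
      using mult_right_cancel by blast
    then show ?thesis unfolding X_def Q_def .
  qed
qed

theorem card_sqzero:
  assumes V: "symplectic V" "card V = q ^ (2 * n)"
  shows "real (card (sqzero V)) = (\<Sum>r\<le>n. rank_count q (real q ^ (2 * n)) r)"
proof -
  have fin: "finite (sqzero V)" using symplecticD(1)[OF V(1)] finite_sqzero by auto
  have "sqzero V = (\<Union>r\<le>n. {N\<in>sqzero V. card (N ` V) = q ^ r})"
    using card_sqzero_image_power[OF V] by auto
  also have "card \<dots> = (\<Sum>r\<le>n. card {N\<in>sqzero V. card (N ` V) = q ^ r})"
    using fin q_ge_2 by (intro card_UN_disjoint) auto
  finally show ?thesis using card_sqzero_rank[OF V] by simp
qed


section \<open>Involutive isometries as square-zero maps\<close>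

text \<open>In characteristic 2 adding the identity is its own inverse, and the square of
  \<open>h + 1\<close> is the square of \<open>h\<close> plus 1. An involutive isometry is
  self-adjoint; conversely, in \<open>B (N x + x) (N y + y)\<close> the mixed terms cancel in pairs
  and \<open>B (N x) (N y) = B x (N (N y)) = 0\<close>.\<close>

lemma bij_add_identity:
  assumes V: "subspace V"
  shows "bij_betw (\<lambda>h. restrict (\<lambda>x. h x + x) V) {h\<in>isometries V V. \<forall>x\<in>V. h (h x) = x} (sqzero V)"
proof (rule bij_betw_byWitness[where f' = "\<lambda>h. restrict (\<lambda>x. h x + x) V"], goal_cases)
  case 1
  show ?case
    by (auto simp: isometries_def linear_map_def PiE_def add.assoc intro!: extensionalityI[of _ V])
next
  case 2
  show ?case
    by (auto simp: sqzero_def linear_map_def PiE_def add.assoc intro!: extensionalityI[of _ V])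
next
  case 3
  show ?case
  proof (rule image_subsetI)
    fix h assume "h \<in> {h\<in>isometries V V. \<forall>x\<in>V. h (h x) = x}"
    then have h: "h \<in> linear_map V V" "\<And>x y. x \<in> V \<Longrightarrow> y \<in> V \<Longrightarrow> B (h x) (h y) = B x y"
        "\<And>x. x \<in> V \<Longrightarrow> h (h x) = x"
      by (auto simp: isometries_def)
    note L = linear_mapD[OF h(1)]
    have adj: "B (h x) y = B x (h y)" if "x \<in> V" "y \<in> V" for x y
      using h(2)[OF L(1)[OF that(1)] that(2)] h(3)[OF that(1)] by simp
    show "restrict (\<lambda>x. h x + x) V \<in> sqzero V"
      unfolding sqzero_def linear_map_def
      by (auto simp: L V subspace_add subspace_scale h(3) B_simps adj scale_right_distrib ac_simps)
  qed
next
  case 4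
  show ?case
  proof (rule image_subsetI)
    fix N assume N: "N \<in> sqzero V"
    note sN = sqzeroD[OF N] and L = linear_mapD[OF sqzeroD(1)[OF N]]
    have "B (N x + x) (N y + y) = B x y" if "x \<in> V" "y \<in> V" for x y
    proof -
      have "B (N x) (N y) = 0" using sN(2)[OF that(1) L(1)[OF that(2)]] sN(3)[OF that(2)] by simp
      then show ?thesis using sN(2)[OF that] by (simp add: B_simps ac_simps)
    qed
    then show "restrict (\<lambda>x. N x + x) V \<in> {h\<in>isometries V V. \<forall>x\<in>V. h (h x) = x}"
      unfolding isometries_def linear_map_def
      by (auto simp: L V subspace_add subspace_scale sN(3) scale_right_distrib ac_simps)
  qed
qed

end

section \<open>From frame counts to quotients of group orders\<close>

text \<open>Group-theoretically this is orbit counting on isotropic frames, the first two factors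
  being the order of the stabilizer of a frame. It is proved here by induction on \<open>r\<close>,
  splitting off the first frame vector together with the top factor of
  \<open>sp_order\<close>.\<close>

lemma sp_order_isotropic_frames:
  assumes q: "2 \<le> q" and "r \<le> n"
  shows "real (sp_order q n) = real q ^ (r * (r + 1) div 2 + r * (2 * n - 2 * r))
    * real (sp_order q (n - r)) * isotropic_frames (real q) (real q ^ (2 * n)) r"
  using \<open>r \<le> n\<close>
proof (induction r arbitrary: n)
  case 0
  then show ?case by (simp add: isotropic_frames_def)
next
  case (Suc r)
  then obtain k where n: "n = Suc k" "r \<le> k" by (cases n) auto
  define Q where "Q = real q"
  have Q: "Q > 0" using q by (simp add: Q_def)
  have tri: "Suc r * (Suc r + 1) div 2 = r * (r + 1) div 2 + (r + 1)"
    by simp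
  have e: "2 * k + 1 + (r * (r + 1) div 2 + r * (2 * k - 2 * r))
      = r + (Suc r * (Suc r + 1) div 2 + Suc r * (2 * n - 2 * Suc r))"
  proof -
    obtain j where "k = r + j" using n(2) le_Suc_ex by blast
    then show ?thesis unfolding tri by (simp add: n(1) algebra_simps)
  qed
  have X: "Q ^ (2 * n) / Q\<^sup>2 = Q ^ (2 * k)"
    using Q by (simp add: n(1) power2_eq_square)
  have "real (sp_order q n) = (Q ^ (2 * n) - 1) * Q ^ (2 * k + 1) * real (sp_order q k)"
    unfolding n(1) sp_order_real_Suc[OF q] Q_def by simp
  also have "\<dots> = (Q ^ (2 * n) - 1) * (Q ^ (2 * k + 1) * Q ^ (r * (r + 1) div 2 + r * (2 * k - 2 * r)))
      * real (sp_order q (n - Suc r)) * isotropic_frames Q (Q ^ (2 * k)) r"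
    unfolding Suc.IH[OF n(2)] Q_def[symmetric] by (simp add: n(1))
  also have "\<dots> = Q ^ (Suc r * (Suc r + 1) div 2 + Suc r * (2 * n - 2 * Suc r))
      * real (sp_order q (n - Suc r)) * ((Q ^ (2 * n) - 1) * Q ^ r * isotropic_frames Q (Q ^ (2 * k)) r)"
    unfolding power_add[symmetric] e unfolding power_add by (simp only: ac_simps)
  also have "(Q ^ (2 * n) - 1) * Q ^ r * isotropic_frames Q (Q ^ (2 * k)) r = isotropic_frames Q (Q ^ (2 * n)) (Suc r)"
    using isotropic_frames_front[OF Q, of "Q ^ (2 * n)" r] by (simp only: X)
  finally show ?case unfolding Q_def .
qed

text \<open>For even \<open>r\<close> at least 2, |Sp(r,q)| is
  \<open>(q ^ r - 1) * q ^ (r - 1)\<close> times |Sp(r-2,q)|, so the two reciprocals add up to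
  \<open>q ^ r\<close> over |Sp(r,q)|. For odd \<open>r\<close> and for \<open>r = 0\<close> only
  one term is present.\<close>

lemma sym_weight_split:
  assumes q: "2 \<le> q"
  shows "sym_weight q r = (if even r then 1 / real (sp_order q (r div 2)) else 0)
    + (if even r \<and> r \<ge> 1 then 1 / (real q ^ (r - 1) * real (sp_order q ((r - 2) div 2))) else 0)
    + (if odd r then 1 / real (sp_order q ((r - 1) div 2)) else 0)"
proof (cases "even r \<and> r \<ge> 1")
  case True
  then obtain m where r: "r = 2 * Suc m"
    by (metis dvd_def mult_0_right not0_implies_Suc not_one_le_zero)
  define s where "s = real (sp_order q m)"
  have s: "s > 0" using sp_order_pos[OF q] by (simp add: s_def)
  have x: "real q ^ r > 1" using q r by (intro one_less_power) auto
  define t where "t = real (sp_order q (Suc m))"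
  have t: "t = (real q ^ r - 1) * real q ^ (r - 1) * s"
    unfolding t_def sp_order_real_Suc[OF q] s_def by (simp add: r)
  have *: "P / ((P - 1) * y * s) = 1 / ((P - 1) * y * s) + 1 / (y * s)"
    if "P > 1" "y > 0" for P y :: real
    using that s by (simp add: divide_simps)
  have "real q ^ (r - 1) > 0" using q by simp
  then have "real q ^ r / t = 1 / t + 1 / (real q ^ (r - 1) * s)"
    unfolding t using * x by blast
  moreover have "r div 2 = Suc m" "(r - 2) div 2 = m" using r by auto
  ultimately show ?thesis using True by (simp add: sym_weight_def s_def t_def del: sp_order.simps)
next
  case False
  then have "r = 0 \<or> odd r" by auto
  then show ?thesis by (auto simp: sym_weight_def elim: oddE)
qed

text \<open>Translation by 1 permutes the field, so comparing the sums of all elements gives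
  \<open>of_nat CARD('a) = 0\<close>; a vanishing power of 2 forces 2 to vanish.\<close>

lemma char_2_of_card_power:
  assumes "CARD('a::{field,finite}) = 2 ^ k"
  shows "(1::'a) + 1 = 0"
proof -
  have "(\<Sum>x\<in>UNIV. x) = (\<Sum>x\<in>UNIV. x + (1::'a))"
    by (rule sum.reindex_bij_witness[of _ "\<lambda>x. x + 1" "\<lambda>x. x - 1"]) auto
  then have "(of_nat CARD('a) :: 'a) = 0" by (simp add: sum.distrib)
  then have "(2 :: 'a) ^ k = 0" using assms by simp
  then show ?thesis by simp
qed

section \<open>Matrices and linear maps\<close>

definition fscale :: "'a::field \<Rightarrow> (nat \<Rightarrow> 'a) \<Rightarrow> nat \<Rightarrow> 'a" where
  "fscale c x = (\<lambda>i. c * x i)"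

text \<open>The locale works in a single abelian group type, so vectors of dimension
  \<open>d\<close> are encoded as functions on the naturals that vanish from \<open>d\<close>
  on.\<close>

definition supported :: "nat \<Rightarrow> (nat \<Rightarrow> 'a::field) set" where
  "supported d = {x. \<forall>i\<ge>d. x i = 0}"

definition of_vec :: "nat \<Rightarrow> 'a::field vec \<Rightarrow> nat \<Rightarrow> 'a" where
  "of_vec d v = (\<lambda>i. if i < d then v $ i else 0)"

text \<open>\<open>vec d\<close> truncates, so this form is bilinear and alternating on all
  functions, and nondegenerate on \<open>supported d\<close>.\<close>

definition vec_form :: "nat \<Rightarrow> ('a::field vec \<Rightarrow> 'a vec \<Rightarrow> 'a) \<Rightarrow> (nat \<Rightarrow> 'a) \<Rightarrow> (nat \<Rightarrow> 'a) \<Rightarrow> 'a" where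
  "vec_form d f x y = f (vec d x) (vec d y)"

definition map_of_mat :: "nat \<Rightarrow> 'a::field mat \<Rightarrow> (nat \<Rightarrow> 'a) \<Rightarrow> nat \<Rightarrow> 'a" where
  "map_of_mat d g = restrict (\<lambda>x. of_vec d (g *\<^sub>v vec d x)) (supported d)"

lemma of_vec_vec: "x \<in> supported d \<Longrightarrow> of_vec d (vec d x) = x"
  by (auto simp: of_vec_def supported_def)

lemma vec_of_vec: "v \<in> carrier_vec d \<Longrightarrow> vec d (of_vec d v) = v"
  by (auto simp: of_vec_def)

lemma of_vec_supported: "of_vec d v \<in> supported d"
  by (simp add: of_vec_def supported_def)

lemma vec_add: "vec d (x + y) = vec d x + vec d y"
  by (auto simp: plus_fun_def)

lemma vec_fscale: "vec d (fscale c x) = c \<cdot>\<^sub>v vec d x"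
  by (auto simp: fscale_def)

lemma of_vec_add: "v \<in> carrier_vec d \<Longrightarrow> w \<in> carrier_vec d \<Longrightarrow> of_vec d (v + w) = of_vec d v + of_vec d w"
  by (auto simp: of_vec_def plus_fun_def)

lemma of_vec_smult: "v \<in> carrier_vec d \<Longrightarrow> of_vec d (c \<cdot>\<^sub>v v) = fscale c (of_vec d v)"
  by (auto simp: of_vec_def fscale_def)

lemma char2_alternating_form_vec_form:
  assumes f: "symplectic_form d f" and q: "CARD('a::{field,finite}) = q" and one: "(1::'a) + 1 = 0"
  shows "char2_alternating_form fscale (vec_form d (f :: 'a vec \<Rightarrow> 'a vec \<Rightarrow> 'a)) q"
proof
  show "vec_form d f (x + y) z = vec_form d f x z + vec_form d f y z"
    "vec_form d f z (x + y) = vec_form d f z x + vec_form d f z y"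
    "vec_form d f (fscale c x) y = c * vec_form d f x y"
    "vec_form d f x (fscale c y) = c * vec_form d f x y" for x y z c
    using f by (simp_all add: symplectic_form_def bilinear_form_def vec_form_def vec_add vec_fscale)
  show "vec_form d f x x = 0" for x
    using f by (simp add: symplectic_form_def alternating_form_def vec_form_def)
qed (use q one in \<open>auto simp: fscale_def fun_eq_iff algebra_simps\<close>)

lemma card_supported: "card (supported d :: (nat \<Rightarrow> 'a::{field,finite}) set) = CARD('a) ^ d"
proof -
  have "bij_betw (\<lambda>x. restrict x {..<d}) (supported d) (PiE {..<d} (\<lambda>_. UNIV :: 'a set))"
    by (rule bij_betw_byWitness[where f' = "\<lambda>y i. if i < d then y i else 0"])
      (auto simp: supported_def fun_eq_iff PiE_def extensional_def)
  then have "card (supported d :: (nat \<Rightarrow> 'a) set) = card (PiE {..<d} (\<lambda>_. UNIV :: 'a set))"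
    by (rule bij_betw_same_card)
  then show ?thesis by (simp add: card_PiE)
qed

lemma finite_supported: "finite (supported d :: (nat \<Rightarrow> 'a::{field,finite}) set)"
  by (rule card_ge_0_finite) (simp add: card_supported)

lemma map_of_mat_supported: "x \<in> supported d \<Longrightarrow> map_of_mat d g x = of_vec d (g *\<^sub>v vec d x)"
  by (simp add: map_of_mat_def)

context
  fixes d q :: nat and f :: "'a::{field,finite} vec \<Rightarrow> 'a vec \<Rightarrow> 'a"
  assumes f: "symplectic_form d f" and q: "CARD('a) = q" and one: "(1::'a) + 1 = 0"
begin

interpretation F: char2_alternating_form fscale "vec_form d f" q
  by (rule char2_alternating_form_vec_form[OF f q one])

lemma subspace_supported: "F.subspace (supported d)"
  by (rule F.subspaceI) (auto simp: supported_def fscale_def)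

lemma symplectic_supported: "F.symplectic (supported d)"
  unfolding F.symplectic_def
proof (intro conjI ballI impI finite_supported subspace_supported)
  fix x assume x: "x \<in> supported d" and "\<forall>y\<in>supported d. vec_form d f x y = 0"
  then have 0: "f (vec d x) (vec d y) = 0" if "y \<in> supported d" for y
    using that by (simp add: vec_form_def)
  have "f (vec d x) v = 0" if "v \<in> carrier_vec d" for v
    using 0[OF of_vec_supported[of d v]] vec_of_vec[OF that] by simp
  then have "vec d x = 0\<^sub>v d"
    using f vec_carrier[of d x] by (auto simp: symplectic_form_def nondegenerate_form_def)
  then have "of_vec d (vec d x) = 0" by (auto simp: of_vec_def)
  then show "x = 0" using of_vec_vec[OF x] by simp
qed

lemma bij_map_of_mat: "bij_betw (map_of_mat d) (carrier_mat d d) (F.linear_map (supported d) (supported d))"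
proof -
  define e :: "nat \<Rightarrow> nat \<Rightarrow> 'a" where "e = (\<lambda>j i. if i = j then 1 else 0)"
  let ?W = "supported d :: (nat \<Rightarrow> 'a) set"
  let ?M = "\<lambda>h. mat d d (\<lambda>(i, j). h (e j) i)"
  have eW: "e j \<in> ?W" if "j < d" for j using that by (auto simp: e_def supported_def)
  have ve: "vec d (e j) = unit_vec d j" for j by (auto simp: e_def unit_vec_def)
  have 1: "?M (map_of_mat d g) = g" if g: "g \<in> carrier_mat d d" for g
    using g by (intro eq_matI) (auto simp: map_of_mat_supported eW ve of_vec_def)
  have 2: "map_of_mat d g \<in> F.linear_map ?W ?W" if g: "g \<in> carrier_mat d d" for g
    using g subspace_supported
    by (auto simp: F.linear_map_def map_of_mat_def of_vec_supported F.subspace_add F.subspace_scale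
        vec_add vec_fscale mult_add_distrib_mat_vec[of _ d d] mult_mat_vec[of _ d d] of_vec_add of_vec_smult)
  have 3: "map_of_mat d (?M h) = h" if h: "h \<in> F.linear_map ?W ?W" for h
  proof (rule extensionalityI[of _ ?W])
    note L = F.linear_mapD[OF h]
    show "h \<in> extensional ?W" by (rule L(4))
    fix x :: "nat \<Rightarrow> 'a" assume x: "x \<in> ?W"
    \<comment> \<open>The truncations of \<open>x\<close> add one coordinate at a time, which
      expands \<open>h x\<close> in the images of the unit vectors by induction.\<close>
    define t where "t k = (\<lambda>i. if i < k then x i else 0)" for k
    have tW: "t k \<in> ?W" if "k \<le> d" for k using that by (auto simp: t_def supported_def)
    have "h (t k) i = (\<Sum>j<k. x j * h (e j) i)" if "k \<le> d" for k i
      using that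
    proof (induction k)
      case 0
      have "t 0 = 0" by (simp add: t_def zero_fun_def)
      then have "h (t 0) = 0" using F.linear_map_0[OF h subspace_supported] by simp
      then show ?case by simp
    next
      case (Suc k)
      have "t (Suc k) = t k + fscale (x k) (e k)"
        by (auto simp: t_def e_def fscale_def less_Suc_eq)
      then have "h (t (Suc k)) = h (t k) + fscale (x k) (h (e k))"
        using L(2)[OF tW, of k "fscale (x k) (e k)"] L(3)[OF eW, of k] Suc.prems
          F.subspace_scale[OF subspace_supported eW, of k "x k"] by simp
      then show ?case using Suc by (simp add: fscale_def)
    qed
    moreover have "t d = x" using x by (auto simp: t_def supported_def)
    ultimately have hx: "h x i = (\<Sum>j<d. x j * h (e j) i)" for i using order_refl by metis
    show "map_of_mat d (?M h) x = h x"
    proof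
      fix i
      show "map_of_mat d (?M h) x i = h x i"
      proof (cases "i < d")
        case True
        then show ?thesis
          by (simp add: map_of_mat_supported[OF x] of_vec_def scalar_prod_def hx lessThan_atLeast0 mult.commute)
      next
        case False
        then show ?thesis using L(1)[OF x] by (simp add: map_of_mat_supported[OF x] of_vec_def supported_def)
      qed
    qed
  qed (simp add: map_of_mat_def)
  show ?thesis
    by (rule bij_betw_byWitness[where f' = ?M]) (use 1 2 3 in auto)
qed

text \<open>Supplies the invertibility that membership in \<open>Sp\<close> asks for: a vector
  killed by \<open>g\<close> is orthogonal to every vector, hence zero, so the determinant is
  nonzero.\<close>

lemma invertible_mat_isometry:
  assumes g: "g \<in> carrier_mat d d"
    and iso: "\<And>x y. x \<in> carrier_vec d \<Longrightarrow> y \<in> carrier_vec d \<Longrightarrow> f (g *\<^sub>v x) (g *\<^sub>v y) = f x y"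
  shows "invertible_mat g"
proof -
  have bil: "f (x + y) z = f x z + f y z" if "x \<in> carrier_vec d" "y \<in> carrier_vec d" "z \<in> carrier_vec d" for x y z
    using f that by (simp add: symplectic_form_def bilinear_form_def)
  have f0: "f (0\<^sub>v d) y = 0" if "y \<in> carrier_vec d" for y
    using bil[of "0\<^sub>v d" "0\<^sub>v d" y] that by simp
  have "det g \<noteq> 0"
    unfolding det_0_iff_vec_prod_zero_field[OF g]
  proof clarify
    fix v assume v: "v \<in> carrier_vec d" "v \<noteq> 0\<^sub>v d" "g *\<^sub>v v = 0\<^sub>v d"
    have "f v y = 0" if "y \<in> carrier_vec d" for y
      using iso[OF v(1) that] v(3) f0[of "g *\<^sub>v y"] g that by simp
    then show False using f v by (auto simp: symplectic_form_def nondegenerate_form_def)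
  qed
  then have "g \<in> Units (ring_mat TYPE('a) d ())" by (rule det_non_zero_imp_unit[OF g])
  then obtain g' where "g' \<in> carrier_mat d d" "g' * g = 1\<^sub>m d" "g * g' = 1\<^sub>m d"
    by (auto simp: Units_def ring_mat_def)
  then show ?thesis using g by (auto simp: invertible_mat_def inverts_mat_def intro!: exI[of _ g'])
qed

lemma bij_Sp: "bij_betw (map_of_mat d) (carrier (Sp d f)) (F.isometries (supported d) (supported d))"
proof -
  have form: "vec_form d f (map_of_mat d g x) (map_of_mat d g y) = f (g *\<^sub>v vec d x) (g *\<^sub>v vec d y)"
    if "g \<in> carrier_mat d d" "x \<in> supported d" "y \<in> supported d" for g and x y
    using that by (simp add: map_of_mat_supported vec_form_def vec_of_vec)
  have lin: "map_of_mat d g \<in> F.linear_map (supported d) (supported d)" if "g \<in> carrier_mat d d" for g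
    using bij_betw_imp_surj_on[OF bij_map_of_mat] that by blast
  have iff: "map_of_mat d g \<in> F.isometries (supported d) (supported d)
      \<longleftrightarrow> (\<forall>x\<in>carrier_vec d. \<forall>y\<in>carrier_vec d. f (g *\<^sub>v x) (g *\<^sub>v y) = f x y)"
    if g: "g \<in> carrier_mat d d" for g
  proof
    assume h: "map_of_mat d g \<in> F.isometries (supported d) (supported d)"
    show "\<forall>x\<in>carrier_vec d. \<forall>y\<in>carrier_vec d. f (g *\<^sub>v x) (g *\<^sub>v y) = f x y"
    proof (intro ballI)
      fix x y :: "'a vec" assume x: "x \<in> carrier_vec d" and y: "y \<in> carrier_vec d"
      have "f (g *\<^sub>v x) (g *\<^sub>v y) = vec_form d f (map_of_mat d g (of_vec d x)) (map_of_mat d g (of_vec d y))"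
        unfolding form[OF g of_vec_supported of_vec_supported] vec_of_vec[OF x] vec_of_vec[OF y] ..
      also have "\<dots> = vec_form d f (of_vec d x) (of_vec d y)"
        using h of_vec_supported[of d x] of_vec_supported[of d y] unfolding F.isometries_def by blast
      also have "\<dots> = f x y"
        unfolding vec_form_def vec_of_vec[OF x] vec_of_vec[OF y] ..
      finally show "f (g *\<^sub>v x) (g *\<^sub>v y) = f x y" .
    qed
  next
    assume "\<forall>x\<in>carrier_vec d. \<forall>y\<in>carrier_vec d. f (g *\<^sub>v x) (g *\<^sub>v y) = f x y"
    then show "map_of_mat d g \<in> F.isometries (supported d) (supported d)"
      using lin[OF g] by (simp add: F.isometries_def form[OF g]) (simp add: vec_form_def)
  qed
  have carrier: "carrier (Sp d f) = {g \<in> carrier_mat d d. map_of_mat d g \<in> F.isometries (supported d) (supported d)}"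
    using iff invertible_mat_isometry by (auto simp: Sp_def)
  have "F.isometries (supported d) (supported d) \<subseteq> F.linear_map (supported d) (supported d)"
    unfolding F.isometries_def by (rule Collect_restrict)
  then have "map_of_mat d ` carrier (Sp d f) = F.isometries (supported d) (supported d)"
    unfolding carrier bij_betw_imp_surj_on[OF bij_map_of_mat, symmetric]
      filter_image[of "map_of_mat d" "carrier_mat d d" "\<lambda>h. h \<in> F.isometries (supported d) (supported d)", symmetric]
    by blast
  then show ?thesis
    by (intro bij_betw_subset[OF bij_map_of_mat]) (simp_all add: carrier)
qed

lemma order_Sp:
  assumes "d = 2 * m"
  shows "order (Sp d f) = sp_order q m"
  using F.card_isometries[OF symplectic_supported symplectic_supported, of m] bij_betw_same_card[OF bij_Sp]
    card_supported[where 'a='a, of d] assms q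
  by (simp add: Coset.order_def)

lemma card_involutions_Sp: "card (involutions (Sp d f)) = card (F.sqzero (supported d))"
proof -
  let ?W = "supported d :: (nat \<Rightarrow> 'a) set"
  have sq: "g [^]\<^bsub>Sp d f\<^esub> (2::nat) = \<one>\<^bsub>Sp d f\<^esub> \<longleftrightarrow> (\<forall>x\<in>?W. map_of_mat d g (map_of_mat d g x) = x)"
    if g: "g \<in> carrier (Sp d f)" for g
  proof -
    have gc: "g \<in> carrier_mat d d" using g by (simp add: Sp_def)
    have "g [^]\<^bsub>Sp d f\<^esub> (2::nat) = g * g"
      using gc by (simp add: numeral_2_eq_2 Sp_def)
    then have "g [^]\<^bsub>Sp d f\<^esub> (2::nat) = \<one>\<^bsub>Sp d f\<^esub> \<longleftrightarrow> map_of_mat d (g * g) = map_of_mat d (1\<^sub>m d)"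
      using bij_betw_imp_inj_on[OF bij_map_of_mat] gc by (auto simp: Sp_def inj_on_def)
    also have "\<dots> \<longleftrightarrow> (\<forall>x\<in>?W. map_of_mat d (g * g) x = map_of_mat d (1\<^sub>m d) x)"
      by (auto simp: map_of_mat_def fun_eq_iff restrict_def)
    also have "\<dots> \<longleftrightarrow> (\<forall>x\<in>?W. map_of_mat d g (map_of_mat d g x) = x)"
      using gc by (intro ball_cong refl) (simp add: map_of_mat_supported of_vec_supported vec_of_vec of_vec_vec
          assoc_mult_mat_vec[of _ d d _ d])
    finally show ?thesis .
  qed
  let ?I = "{h\<in>F.isometries ?W ?W. \<forall>x\<in>?W. h (h x) = x}"
  have "?I = map_of_mat d ` involutions (Sp d f)"
    unfolding bij_betw_imp_surj_on[OF bij_Sp, symmetric] involutions_def filter_image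
    by (rule arg_cong[where f = "image (map_of_mat d)"]) (use sq in auto)
  moreover have "inj_on (map_of_mat d) (involutions (Sp d f))"
    using bij_betw_imp_inj_on[OF bij_Sp] by (rule inj_on_subset) (auto simp: involutions_def)
  ultimately have "card (involutions (Sp d f)) = card ?I" by (simp add: card_image)
  also have "\<dots> = card (F.sqzero ?W)"
    by (rule bij_betw_same_card[OF F.bij_add_identity[OF subspace_supported]])
  finally show ?thesis .
qed

lemma card_involutions_rank_count:
  assumes "d = 2 * n"
  shows "real (card (involutions (Sp d f))) = (\<Sum>r\<le>n. rank_count q (real q ^ (2 * n)) r)"
  unfolding card_involutions_Sp
  by (rule F.card_sqzero[OF symplectic_supported]) (use assms q in \<open>simp add: card_supported\<close>)

end

theorem theorem4p3:
  fixes q n :: nat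
    and f :: "nat \<Rightarrow> 'a::{field,finite} vec \<Rightarrow> 'a vec \<Rightarrow> 'a"
    and S :: "nat \<Rightarrow> real" and A B C :: "nat \<Rightarrow> real"
  assumes "CARD('a) = q" and "\<exists>k. q = 2 ^ k" and "n \<ge> 1"
    and "\<And>d. even d \<Longrightarrow> d \<le> 2 * n \<Longrightarrow> symplectic_form d (f d)"
  defines "S \<equiv> \<lambda>d. real (order (Sp d (f d)))"
  defines "A \<equiv> \<lambda>r. real q ^ (r * (r + 1) div 2 + r * (2 * n - 2 * r)) * S r * S (2 * n - 2 * r)"
    and "B \<equiv> \<lambda>r. real q ^ (r * (r + 1) div 2 + r * (2 * n - 2 * r)) * real q ^ (r - 1) *
                  S (r - 2) * S (2 * n - 2 * r)"
    and "C \<equiv> \<lambda>r. real q ^ (r * (r + 1) div 2 + r * (2 * n - 2 * r)) *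
                  S (r - 1) * S (2 * n - 2 * r)"
  shows "real (card (involutions (Sp (2 * n) (f (2 * n))))) =
           (\<Sum>r\<in>{r\<in>{0..n}. even r}. S (2 * n) / A r) +
           (\<Sum>r\<in>{r\<in>{1..n}. even r}. S (2 * n) / B r) +
           (\<Sum>r\<in>{r\<in>{1..n}. odd r}. S (2 * n) / C r)"
proof -
  obtain k where "q = 2 ^ k" using assms(2) by blast
  then have one: "(1::'a) + 1 = 0" using char_2_of_card_power assms(1) by metis
  have q: "2 \<le> q" using card_field_ge_2[where 'a='a] assms(1) by simp
  have S: "S d = real (sp_order q (d div 2))" if "even d" "d \<le> 2 * n" for d
    unfolding S_def using order_Sp[OF assms(4)[OF that] assms(1) one, of "d div 2"] that by simp
  define I where "I = isotropic_frames (real q) (real q ^ (2 * n))"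
  let ?w = "\<lambda>r. real q ^ (r * (r + 1) div 2 + r * (2 * n - 2 * r))"
  \<comment> \<open>The factors common to \<open>A r\<close>, \<open>B r\<close> and
    \<open>C r\<close> turn |Sp(2n,q)| into the number of isotropic frames; only the three
    reciprocals that make up \<open>sym_weight\<close> remain.\<close>
  have I: "S (2 * n) / (?w r * S (2 * n - 2 * r)) = I r" if "r \<le> n" for r
  proof -
    have "S (2 * n - 2 * r) = real (sp_order q (n - r))" using S[of "2 * n - 2 * r"] by (simp add: diff_mult_distrib2[symmetric])
    moreover have "S (2 * n) = ?w r * real (sp_order q (n - r)) * I r"
      using S[of "2 * n"] sp_order_isotropic_frames[OF q that] by (simp add: I_def)
    ultimately show ?thesis using q sp_order_pos[OF q, of "n - r"] by simp
  qed
  have A: "S (2 * n) / A r = I r * (1 / real (sp_order q (r div 2)))" if "r \<le> n" "even r" for r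
    unfolding A_def I[OF that(1), symmetric] using S[of r] that by (simp add: ac_simps)
  \<comment> \<open>At \<open>r = 0\<close> natural subtraction truncates alike on both sides; the
    sum itself takes only even \<open>r\<close> from 2 on.\<close>
  have B: "S (2 * n) / B r = I r * (1 / (real q ^ (r - 1) * real (sp_order q ((r - 2) div 2))))" if "r \<le> n" "even r" for r
    unfolding B_def I[OF that(1), symmetric] using S[of "r - 2"] that by (simp add: ac_simps)
  have C: "S (2 * n) / C r = I r * (1 / real (sp_order q ((r - 1) div 2)))" if "r \<le> n" "odd r" for r
    unfolding C_def I[OF that(1), symmetric] using S[of "r - 1"] that by (simp add: ac_simps)
  \<comment> \<open>All three sums are put over the same range \<open>{..n}\<close> so that they can
    be merged termwise; an odd index is at least 1 anyway.\<close>
  have sets: "{r\<in>{0..n}. even r} = {r\<in>{..n}. even r}" "{r\<in>{1..n}. even r} = {r\<in>{..n}. even r \<and> r \<ge> 1}"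
    "{r\<in>{1..n}. odd r} = {r\<in>{..n}. odd r}" by (auto elim: oddE)
  have "real (card (involutions (Sp (2 * n) (f (2 * n))))) = (\<Sum>r\<le>n. rank_count q (real q ^ (2 * n)) r)"
    by (rule card_involutions_rank_count[OF assms(4) assms(1) one]) auto
  also have "\<dots> = (\<Sum>r\<le>n. (if even r then S (2 * n) / A r else 0)
      + (if even r \<and> r \<ge> 1 then S (2 * n) / B r else 0) + (if odd r then S (2 * n) / C r else 0))"
  proof (rule sum.cong[OF refl])
    fix r assume "r \<in> {..n}"
    then have "r \<le> n" by simp
    then show "rank_count q (real q ^ (2 * n)) r = (if even r then S (2 * n) / A r else 0)
      + (if even r \<and> r \<ge> 1 then S (2 * n) / B r else 0) + (if odd r then S (2 * n) / C r else 0)"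
      unfolding rank_count_def I_def[symmetric] sym_weight_split[OF q, of r]
      using A[of r] B[of r] C[of r] by (simp add: distrib_left)
  qed
  also have "\<dots> = (\<Sum>r\<in>{r\<in>{0..n}. even r}. S (2 * n) / A r) +
           (\<Sum>r\<in>{r\<in>{1..n}. even r}. S (2 * n) / B r) +
           (\<Sum>r\<in>{r\<in>{1..n}. odd r}. S (2 * n) / C r)"
    unfolding sets sum.distrib by (simp only: sum.inter_filter[OF finite_atMost])
  finally show ?thesis .
qed

end
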